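(* Let $2\le r<\infty$ and let $\mathbb{F}_r$ act (not necessarily freely) by a Borel probability-measure-preserving action $\alpha$ on a standard probability space $(X,\mu)$. Let $\mathfrak{m}$ be a stationary Markov measure (with positive initial distribution) on $S_r^{<\mathbb{N}}$ whose support is contained in $\mathbb{F}_r$. Suppose that the boundary action $\beta$ of $\mathbb{F}_r$ on $(\partial\mathbb{F}_r,\mathbb{P}_{\mathfrak{m}})$ is weakly mixing. Then for every $f\in L^1(X,\mu)$, for $\mu$-a.e. $x\in X$, \[ \frac{1}{\mathfrak{m}(\tau)}\sum_{w\in\tau}f(w\cdot x)\,\mathfrak{m}(w)\to\overline{f}(x)\quad\text{as }\mathfrak{m}(\tau)\to\infty, \] where $\tau$ ranges over all finite subtrees of the left Cayley graph of $\mathbb{F}_r$ containing the identity, and $\overline{f}$ is the conditional expectation of $f$ with respect to the $\sigma$-algebra of $\alpha$-invariant Borel sets.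
   Context: $\mathbb{N}$ includes $0$. $S_r$ is the standard symmetric generating set of the free group $\mathbb{F}_r$ ($r$ free generators and their inverses). Elements of $\mathbb{F}_r$ are identified with reduced finite words in $S_r$, and $\partial\mathbb{F}_r\subseteq S_r^{\mathbb{N}}$ is the set of infinite reduced words. The boundary action $\beta$ is $w\cdot x:=$ the reduction of the concatenation $w^\frown x$. The left Cayley graph has edges between $w$ and $aw$ ($w\in\mathbb{F}_r$, $a\in S_r$); a subtree is identified with its (connected) vertex set. The Markov measure $\mathfrak{m}$ on $S_r^{<\mathbb{N}}$ (finite words) with (row-stochastic) transition matrix $P$ and initial distribution $\pi$ is $\mathfrak{m}(w):=\pi(w(0))P(w(0),w(1))\cdots P(w(\ell-2),w(\ell-1))$ for a nonempty word $w$ of length $\ell$, and $\mathfrak{m}(\emptyset):=1$; $\mathfrak{m}(\tau):=\sum_{w\in\tau}\mathfrak{m}(w)$. It is stationary if $\pi P=\pi$. Standing assumption: all entries of $\pi$ are positive. $\mathbb{P}_{\mathfrak{m}}$ is the Borel probability measure on $S_r^{\mathbb{N}}$ with $\mathbb{P}_{\mathfrak{m}}\{x:w\text{ is an initial subword of }x\}=\mathfrak{m}(w)$ for all finite words $w$; since the support of $\mathfrak{m}$ is contained in $\mathbb{F}_r$ (i.e. $P(a,a^{-1})=0$ for all $a\in S_r$), it is concentrated on $\partial\mathbb{F}_r$. The boundary action on $(\partial\mathbb{F}_r,\mathbb{P}_{\mathfrak{m}})$ is weakly mixing if the product (diagonal action) of $\beta$ with any ergodic pmp action of $\mathbb{F}_r$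 on a standard probability space is ergodic with respect to the product measure (every invariant Borel set is null or conull). The convergence "as $\mathfrak{m}(\tau)\to\infty$" means: for every $\varepsilon>0$ there is $M>0$ such that for all such $\tau$ with $\mathfrak{m}(\tau)\ge M$ the average is within $\varepsilon$ of $\overline{f}(x)$. *)

theory Defs
  imports "HOL-Probability.Probability" "HOL-Algebra.Group_Action"
begin

section \<open>Actions on probability spaces\<close>

text \<open>Standard Borel spaces; the topology need not come from a type class instance.\<close>

definition standard_borel :: "'a measure \<Rightarrow> bool" where
  "standard_borel M \<longleftrightarrow>
     (\<exists>T. topspace T = space M \<and> completely_metrizable_space T \<and> second_countable T \<and>
          sets M = sigma_sets (space M) {U. openin T U})"

text \<open>In \<^locale>\<open>group_action\<close> the maps \<^term>\<open>\<phi> g\<close> are extensional bijections of the space, so they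
  carry no information outside of it.\<close>

definition pmp_action :: "('g, 'm) monoid_scheme \<Rightarrow> 'a measure \<Rightarrow> ('g \<Rightarrow> 'a \<Rightarrow> 'a) \<Rightarrow> bool" where
  "pmp_action G M \<phi> \<longleftrightarrow>
     prob_space M \<and> group_action G (space M) \<phi> \<and>
     (\<forall>g\<in>carrier G. \<phi> g \<in> measurable M M \<and> distr M M (\<phi> g) = M)"

definition invariant_sets :: "('g, 'm) monoid_scheme \<Rightarrow> 'a measure \<Rightarrow> ('g \<Rightarrow> 'a \<Rightarrow> 'a) \<Rightarrow> 'a set set" where
  "invariant_sets G M \<phi> = {A \<in> sets M. \<forall>g\<in>carrier G. \<phi> g ` A = A}"

definition invariant_algebra :: "('g, 'm) monoid_scheme \<Rightarrow> 'a measure \<Rightarrow> ('g \<Rightarrow> 'a \<Rightarrow> 'a) \<Rightarrow> 'a measure" where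
  "invariant_algebra G M \<phi> = sigma (space M) (invariant_sets G M \<phi>)"

text \<open>No invariance of the measure is required here.\<close>

definition ergodic_action :: "('g, 'm) monoid_scheme \<Rightarrow> 'a measure \<Rightarrow> ('g \<Rightarrow> 'a \<Rightarrow> 'a) \<Rightarrow> bool" where
  "ergodic_action G M \<phi> \<longleftrightarrow>
     (\<forall>A\<in>invariant_sets G M \<phi>. A \<in> null_sets M \<or> space M - A \<in> null_sets M)"

text \<open>A standard Borel space has at most the cardinality of the continuum, so up to isomorphism
  every standard probability space has a subset of \<^typ>\<open>real\<close> as its underlying set. This set,
  its Polish topology and the measure are arbitrary; the topology of the real line plays no role.\<close>

definition weakly_mixing :: "('g, 'm) monoid_scheme \<Rightarrow> 'a measure \<Rightarrow> ('g \<Rightarrow> 'a \<Rightarrow> 'a) \<Rightarrow> bool" where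
  "weakly_mixing G M \<phi> \<longleftrightarrow>
     (\<forall>(N :: real measure) \<psi>.
        standard_borel N \<longrightarrow> pmp_action G N \<psi> \<longrightarrow> ergodic_action G N \<psi> \<longrightarrow>
        ergodic_action G (M \<Otimes>\<^sub>M N) (\<lambda>g. map_prod (\<phi> g) (\<psi> g)))"


section \<open>Free groups and their boundary\<close>

text \<open>The letter \<^term>\<open>(g, True)\<close> is the generator \<^term>\<open>g\<close> and \<^term>\<open>(g, False)\<close> its inverse. The
  rank is the cardinality of the type of generators.\<close>

type_synonym 'g letter = "'g \<times> bool"

definition letter_inv :: "'g letter \<Rightarrow> 'g letter" where
  "letter_inv a = (fst a, \<not> snd a)"

definition reduced_word :: "'g letter list \<Rightarrow> bool" where
  "reduced_word w \<longleftrightarrow> successively (\<lambda>a b. b \<noteq> letter_inv a) w"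

fun push :: "'g letter \<Rightarrow> 'g letter list \<Rightarrow> 'g letter list" where
  "push a [] = [a]"
| "push a (b # w) = (if b = letter_inv a then w else a # b # w)"

definition reduce :: "'g letter list \<Rightarrow> 'g letter list" where
  "reduce w = foldr push w []"

definition free_group :: "'g letter list monoid" where
  "free_group = \<lparr>carrier = {w. reduced_word w}, mult = (\<lambda>u v. reduce (u @ v)), one = []\<rparr>"

definition boundary :: "(nat \<Rightarrow> 'g letter) set" where
  "boundary = {x. \<forall>n. x (Suc n) \<noteq> letter_inv (x n)}"

definition push_inf :: "'g letter \<Rightarrow> (nat \<Rightarrow> 'g letter) \<Rightarrow> nat \<Rightarrow> 'g letter" where
  "push_inf a x = (if x 0 = letter_inv a then (\<lambda>n. x (Suc n)) else case_nat a x)"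

text \<open>The reduction of \<^term>\<open>w\<close> followed by \<^term>\<open>x\<close>, obtained by pushing the letters of \<^term>\<open>w\<close> onto
  the reduced infinite word \<^term>\<open>x\<close>, last letter first.\<close>

definition boundary_action :: "'g letter list \<Rightarrow> (nat \<Rightarrow> 'g letter) \<Rightarrow> nat \<Rightarrow> 'g letter" where
  "boundary_action w = (\<lambda>x\<in>boundary. foldr push_inf w x)"

text \<open>The edges of the left Cayley graph, in both directions since \<^term>\<open>a\<close> ranges over all letters.\<close>

definition cayley_edges :: "('g letter list \<times> 'g letter list) set" where
  "cayley_edges = {(w, [a] \<otimes>\<^bsub>free_group\<^esub> w) | w a. w \<in> carrier free_group}"

text \<open>The Cayley graph is a tree, so its subtrees are its connected induced subgraphs.\<close>

definition cayley_subtree :: "'g letter list set \<Rightarrow> bool" where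
  "cayley_subtree \<tau> \<longleftrightarrow>
     \<tau> \<subseteq> carrier free_group \<and> (\<forall>u\<in>\<tau>. \<forall>v\<in>\<tau>. (u, v) \<in> (cayley_edges \<inter> \<tau> \<times> \<tau>)\<^sup>*)"


section \<open>Markov measures\<close>

definition markov_chain :: "('s::finite \<Rightarrow> real) \<Rightarrow> ('s \<Rightarrow> 's \<Rightarrow> real) \<Rightarrow> bool" where
  "markov_chain \<pi> P \<longleftrightarrow>
     (\<forall>a. 0 \<le> \<pi> a) \<and> (\<Sum>a\<in>UNIV. \<pi> a) = 1 \<and>
     (\<forall>a b. 0 \<le> P a b) \<and> (\<forall>a. (\<Sum>b\<in>UNIV. P a b) = 1)"

definition stationary :: "('s::finite \<Rightarrow> real) \<Rightarrow> ('s \<Rightarrow> 's \<Rightarrow> real) \<Rightarrow> bool" where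
  "stationary \<pi> P \<longleftrightarrow> (\<forall>b. (\<Sum>a\<in>UNIV. \<pi> a * P a b) = \<pi> b)"

definition markov_measure :: "('s \<Rightarrow> real) \<Rightarrow> ('s \<Rightarrow> 's \<Rightarrow> real) \<Rightarrow> 's list \<Rightarrow> real" where
  "markov_measure \<pi> P w =
     (if w = [] then 1 else \<pi> (w ! 0) * (\<Prod>i<length w - 1. P (w ! i) (w ! Suc i)))"

definition cylinder :: "'s list \<Rightarrow> (nat \<Rightarrow> 's) set" where
  "cylinder w = {x. \<forall>i<length w. x i = w ! i}"

text \<open>For a finite alphabet, the product of the discrete sigma-algebras is the Borel sigma-algebra
  of the product topology.\<close>

definition path_measure :: "('s \<Rightarrow> real) \<Rightarrow> ('s \<Rightarrow> 's \<Rightarrow> real) \<Rightarrow> (nat \<Rightarrow> 's) measure" where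
  "path_measure \<pi> P =
     (THE B. sets B = sets (\<Pi>\<^sub>M i\<in>UNIV. count_space UNIV) \<and> prob_space B \<and>
        (\<forall>w. measure B (cylinder w) = markov_measure \<pi> P w))"

definition boundary_measure :: "('g letter \<Rightarrow> real) \<Rightarrow> ('g letter \<Rightarrow> 'g letter \<Rightarrow> real) \<Rightarrow>
    (nat \<Rightarrow> 'g letter) measure" where
  "boundary_measure \<pi> P = restrict_space (path_measure \<pi> P) boundary"


section \<open>The definitions are meaningful\<close>

lemma letter_inv_inv [simp]: "letter_inv (letter_inv a) = a"
  by (simp add: letter_inv_def)

lemma letter_inv_neq [simp]: "letter_inv a \<noteq> a" "a \<noteq> letter_inv a"
  by (simp_all add: letter_inv_def prod_eq_iff)

lemma letter_inv_eq_iff [simp]: "letter_inv a = letter_inv b \<longleftrightarrow> a = b"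
  by (metis letter_inv_inv)

lemma reduced_Nil [simp]: "reduced_word []"
  by (simp add: reduced_word_def)

lemma reduced_Cons: "reduced_word (a # w) \<longleftrightarrow> (w = [] \<or> hd w \<noteq> letter_inv a) \<and> reduced_word w"
  by (cases w) (auto simp: reduced_word_def)

lemma reduced_push: "reduced_word w \<Longrightarrow> reduced_word (push a w)"
  by (cases w) (auto simp: reduced_Cons)

lemma push_push: "reduced_word w \<Longrightarrow> push (letter_inv a) (push a w) = w"
  by (cases w; cases "tl w") (auto simp: reduced_Cons)

lemma reduced_foldr_push: "reduced_word v \<Longrightarrow> reduced_word (foldr push u v)"
  by (induction u) (auto intro: reduced_push)

lemma reduced_reduce: "reduced_word (reduce w)"
  by (simp add: reduce_def reduced_foldr_push)

lemma reduce_reduced: "reduced_word w \<Longrightarrow> reduce w = w"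
proof (induction w)
  case (Cons a w)
  then show ?case by (cases w) (auto simp: reduce_def reduced_Cons)
qed (simp add: reduce_def)

lemma foldr_closed:
  assumes "\<And>a x. x \<in> S \<Longrightarrow> p a x \<in> S" and "x \<in> S"
  shows "foldr p u x \<in> S"
  using assms by (induction u) auto

lemma foldr_reduce:
  assumes cl: "\<And>a x. x \<in> S \<Longrightarrow> p a x \<in> S"
    and inv: "\<And>a x. x \<in> S \<Longrightarrow> p (letter_inv a) (p a x) = x" and x: "x \<in> S"
  shows "foldr p (reduce u) x = foldr p u x"
proof -
  have push: "foldr p (push a w) x = p a (foldr p w x)" for a w
  proof (cases w)
    case (Cons b v)
    have "p a (p (letter_inv a) (foldr p v x)) = foldr p v x"
      using inv[of "foldr p v x" "letter_inv a"] foldr_closed[of S p, OF cl x] by simp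
    with Cons show ?thesis by auto
  qed simp
  show ?thesis
    by (induction u) (simp_all add: reduce_def push)
qed

lemma foldr_inverse:
  assumes cl: "\<And>a x. x \<in> S \<Longrightarrow> p a x \<in> S"
    and inv: "\<And>a x. x \<in> S \<Longrightarrow> p (letter_inv a) (p a x) = x" and x: "x \<in> S"
  shows "foldr p (map letter_inv (rev u)) (foldr p u x) = x"
proof (induction u)
  case (Cons a u)
  then show ?case using inv[of "foldr p u x" a] foldr_closed[of S p, OF cl x] by simp
qed simp

lemma mult_free_group:
  "v \<in> carrier free_group \<Longrightarrow> u \<otimes>\<^bsub>free_group\<^esub> v = foldr push u v"
  using reduce_reduced[of v] by (simp add: free_group_def reduce_def)

lemma carrier_free_group [simp]: "carrier free_group = {w. reduced_word w}"
  by (simp add: free_group_def)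

lemma one_free_group [simp]: "\<one>\<^bsub>free_group\<^esub> = []"
  by (simp add: free_group_def)

lemma group_free_group: "group (free_group :: 'g letter list monoid)"
proof (rule groupI)
  fix u v w :: "'g letter list"
  assume uvw: "u \<in> carrier free_group" "v \<in> carrier free_group" "w \<in> carrier free_group"
  then show closed: "u \<otimes>\<^bsub>free_group\<^esub> v \<in> carrier free_group"
    by (simp add: free_group_def reduced_reduce)
  have "u \<otimes>\<^bsub>free_group\<^esub> v \<otimes>\<^bsub>free_group\<^esub> w = foldr push (reduce (u @ v)) w"
    using uvw by (subst mult_free_group) (auto simp: free_group_def)
  also have "\<dots> = foldr push u (foldr push v w)"
    using uvw foldr_reduce[of "{w. reduced_word w}" push w "u @ v"] by (simp add: reduced_push push_push)
  also have "\<dots> = u \<otimes>\<^bsub>free_group\<^esub> (v \<otimes>\<^bsub>free_group\<^esub> w)"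
    using uvw by (simp add: mult_free_group reduced_foldr_push)
  finally show "u \<otimes>\<^bsub>free_group\<^esub> v \<otimes>\<^bsub>free_group\<^esub> w = u \<otimes>\<^bsub>free_group\<^esub> (v \<otimes>\<^bsub>free_group\<^esub> w)" .
next
  fix u :: "'g letter list"
  assume u: "u \<in> carrier free_group"
  then show "\<one>\<^bsub>free_group\<^esub> \<otimes>\<^bsub>free_group\<^esub> u = u"
    by (simp add: mult_free_group)
  have "reduce (map letter_inv (rev u)) \<otimes>\<^bsub>free_group\<^esub> u = foldr push (map letter_inv (rev u)) u"
    using u foldr_reduce[of "{w. reduced_word w}" push u] by (simp add: mult_free_group reduced_push push_push)
  also have "\<dots> = foldr push (map letter_inv (rev u)) (foldr push u [])"
    using u reduce_reduced[of u] by (simp add: reduce_def)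
  also have "\<dots> = []"
    by (rule foldr_inverse[where S = "{w. reduced_word w}"]) (auto simp: reduced_push push_push)
  finally show "\<exists>v\<in>carrier free_group. v \<otimes>\<^bsub>free_group\<^esub> u = \<one>\<^bsub>free_group\<^esub>"
    by (intro bexI[of _ "reduce (map letter_inv (rev u))"]) (auto simp: reduced_reduce)
qed simp

lemma push_inf_boundary: "x \<in> boundary \<Longrightarrow> push_inf a x \<in> boundary"
  by (auto simp: boundary_def push_inf_def split: nat.split)

lemma push_inf_push_inf: "x \<in> boundary \<Longrightarrow> push_inf (letter_inv a) (push_inf a x) = x"
proof (cases "x 0 = letter_inv a")
  case True
  moreover assume "x \<in> boundary"
  then have "x (Suc 0) \<noteq> letter_inv (x 0)" by (simp add: boundary_def)
  ultimately show ?thesis by (auto simp: push_inf_def fun_eq_iff split: nat.split)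
qed (simp add: push_inf_def)

lemma group_action_boundary:
  "group_action (free_group :: 'g letter list monoid) boundary boundary_action"
proof -
  interpret group "free_group :: 'g letter list monoid" by (rule group_free_group)
  have closed: "foldr push_inf w x \<in> boundary" if "x \<in> boundary" for w and x :: "nat \<Rightarrow> 'g letter"
    using foldr_closed[of boundary push_inf, OF push_inf_boundary that] .
  have inverse: "foldr push_inf (map letter_inv (rev w)) (foldr push_inf w x) = x"
    if "x \<in> boundary" for w and x :: "nat \<Rightarrow> 'g letter"
    using foldr_inverse[of boundary push_inf, OF push_inf_boundary push_inf_push_inf that] .
  have inverse': "foldr push_inf w (foldr push_inf (map letter_inv (rev w)) x) = x"
    if "x \<in> boundary" for w and x :: "nat \<Rightarrow> 'g letter"
    using inverse[OF that, of "map letter_inv (rev w)"] by (simp add: rev_map comp_def)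
  have bij: "boundary_action w \<in> Bij boundary" for w :: "'g letter list"
  proof -
    have "bij_betw (foldr push_inf w) boundary boundary"
      by (rule bij_betwI[where g = "foldr push_inf (map letter_inv (rev w))"])
        (auto simp: closed inverse inverse')
    then show ?thesis
      by (simp add: Bij_def boundary_action_def)
  qed
  show ?thesis
    unfolding group_action_def
  proof (intro group_hom.intro group_hom_axioms.intro homI group_BijGroup is_group)
    fix u v :: "'g letter list"
    show "boundary_action (u \<otimes>\<^bsub>free_group\<^esub> v) = boundary_action u \<otimes>\<^bsub>BijGroup boundary\<^esub> boundary_action v"
      using bij foldr_reduce[of boundary push_inf _ "u @ v", OF push_inf_boundary push_inf_push_inf]
      by (auto simp: BijGroup_def compose_def boundary_action_def free_group_def closed fun_eq_iff)
  qed (use bij in \<open>auto simp: BijGroup_def\<close>)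
qed

lemma measurable_cylinder:
  "cylinder w \<in> sets (\<Pi>\<^sub>M i\<in>UNIV. count_space (UNIV :: 's set))"
proof -
  have "{x \<in> space (\<Pi>\<^sub>M i\<in>UNIV. count_space (UNIV :: 's set)). \<forall>i<length w. x i = w ! i}
      \<in> sets (\<Pi>\<^sub>M i\<in>UNIV. count_space UNIV)"
    by measurable
  then show ?thesis
    by (simp add: cylinder_def space_PiM)
qed

lemma disjoint_cylinders:
  "length v = length w \<Longrightarrow> v \<noteq> w \<Longrightarrow> cylinder v \<inter> cylinder w = {}"
  by (fastforce simp: cylinder_def list_eq_iff_nth_eq)

lemma eq_measure_cylinder:
  fixes B C :: "(nat \<Rightarrow> 's::finite) measure"
  assumes B: "prob_space B" "sets B = sets (\<Pi>\<^sub>M i\<in>UNIV. count_space UNIV)"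
    and C: "prob_space C" "sets C = sets (\<Pi>\<^sub>M i\<in>UNIV. count_space UNIV)"
    and eq: "\<And>w. measure B (cylinder w) = measure C (cylinder w)"
  shows "B = C"
proof (rule measure_eqI_PiM_infinite[OF B(2) C(2)])
  interpret B: prob_space B by fact
  interpret C: prob_space C by fact
  show "finite_measure B" by unfold_locales
  fix A :: "nat \<Rightarrow> 's set" and J :: "nat set"
  assume J: "finite J"
  define S where "S = prod_emb UNIV (\<lambda>i. count_space UNIV) J (Pi\<^sub>E J A)"
  have S: "x \<in> S \<longleftrightarrow> (\<forall>i\<in>J. x i \<in> A i)" for x
    by (auto simp: S_def prod_emb_def space_PiM)
  obtain n where n: "\<And>i. i \<in> J \<Longrightarrow> i < n"
    using J by (meson finite_nat_set_iff_bounded)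
  define W where "W = {w. length w = n \<and> (\<forall>i\<in>J. w ! i \<in> A i)}"
  have W: "finite W"
    by (rule finite_subset[OF _ finite_lists_length_eq[of UNIV n]]) (auto simp: W_def)
  have disj: "disjoint_family_on cylinder W"
    by (auto simp: disjoint_family_on_def W_def dest!: disjoint_cylinders[rotated])
  have "x \<in> (\<Union>w\<in>W. cylinder w)" if "x \<in> S" for x
    using that n by (intro UN_I[of "map x [0..<n]"]) (auto simp: S W_def cylinder_def)
  moreover have "x \<in> S" if "x \<in> (\<Union>w\<in>W. cylinder w)" for x
    using that n by (auto simp: S W_def cylinder_def)
  ultimately have S_eq: "S = (\<Union>w\<in>W. cylinder w)"
    by blast
  have "measure B S = (\<Sum>w\<in>W. measure B (cylinder w))"
    unfolding S_eq using W disj by (intro B.finite_measure_finite_Union) (auto simp: B(2) measurable_cylinder)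
  moreover have "measure C S = (\<Sum>w\<in>W. measure C (cylinder w))"
    unfolding S_eq using W disj by (intro C.finite_measure_finite_Union) (auto simp: C(2) measurable_cylinder)
  ultimately show "emeasure B S = emeasure C S"
    by (simp add: B.emeasure_eq_measure C.emeasure_eq_measure eq)
qed

lemma markov_measure_snoc:
  "markov_measure \<pi> P (w @ [a]) = markov_measure \<pi> P w * (if w = [] then \<pi> a else P (last w) a)"
proof (cases "w = []")
  case False
  then obtain k where k: "length w = Suc k" by (cases w) auto
  have "(\<Prod>i<k. P ((w @ [a]) ! i) ((w @ [a]) ! Suc i)) = (\<Prod>i<k. P (w ! i) (w ! Suc i))"
    using k by (intro prod.cong) (auto simp: nth_append)
  with False k show ?thesis
    by (simp add: markov_measure_def nth_append last_conv_nth)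
qed (simp add: markov_measure_def)

lemma markov_measure_nonneg: "markov_chain \<pi> P \<Longrightarrow> 0 \<le> markov_measure \<pi> P w"
  by (simp add: markov_chain_def markov_measure_def prod_nonneg)

lemma path_measure_exists:
  fixes \<pi> :: "'s::finite \<Rightarrow> real"
  assumes mc: "markov_chain \<pi> P"
  shows "\<exists>B. sets B = sets (\<Pi>\<^sub>M i\<in>UNIV. count_space UNIV) \<and> prob_space B \<and>
           (\<forall>w. measure B (cylinder w) = markov_measure \<pi> P w)"
proof -
  define K :: "nat \<Rightarrow> (nat \<Rightarrow> 's) \<Rightarrow> 's measure" where
    "K n x = measure_pmf (embed_pmf (if n = 0 then \<pi> else P (x (n - 1))))" for n x
  have pmf: "pmf (embed_pmf (if n = 0 then \<pi> else P (x (n - 1)))) a = (if n = 0 then \<pi> a else P (x (n - 1)) a)"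
    for n a and x :: "nat \<Rightarrow> 's"
    using mc by (subst pmf_embed_pmf) (auto simp: markov_chain_def nn_integral_count_space_finite)
  have em: "emeasure (K n x) {a} = (if n = 0 then \<pi> a else P (x (n - 1)) a)" for n x a
    using pmf[of n x a] by (simp add: K_def emeasure_pmf_single)
  have K_meas: "K n \<in> measurable (PiM {0..<n} (\<lambda>_. count_space UNIV)) (subprob_algebra (count_space UNIV))" for n
  proof (cases n)
    case 0
    then show ?thesis
      by (auto simp: K_def[abs_def] intro!: measurable_const measure_pmf_in_subprob_algebra)
  next
    case (Suc k)
    have "(\<lambda>x. x k) \<in> measurable (PiM {0..<n} (\<lambda>_. count_space UNIV)) (count_space (UNIV :: 's set))"
      using Suc by (intro measurable_component_singleton) auto
    moreover have "(\<lambda>a. measure_pmf (embed_pmf (P a))) \<in> measurable (count_space UNIV) (subprob_algebra (count_space UNIV))"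
      by (auto intro: measure_pmf_in_subprob_algebra)
    ultimately have "(\<lambda>x. measure_pmf (embed_pmf (P (x k))))
        \<in> measurable (PiM {0..<n} (\<lambda>_. count_space UNIV)) (subprob_algebra (count_space UNIV))"
      by (rule measurable_compose)
    with Suc show ?thesis by (simp add: K_def[abs_def])
  qed
  interpret IT: Ionescu_Tulcea K "\<lambda>_. count_space UNIV"
    using K_meas by unfold_locales (auto simp: K_def prob_space_measure_pmf)
  define cyl :: "nat \<Rightarrow> 's list \<Rightarrow> (nat \<Rightarrow> 's) set" where
    "cyl n w = {x \<in> extensional {0..<n}. \<forall>i<length w. x i = w ! i}" for n w
  have cyl_sets: "cyl n w \<in> sets (PiM {0..<n} (\<lambda>_. count_space UNIV))" if "length w = n" for n w
  proof -
    have "cyl n w = Pi\<^sub>E {0..<n} (\<lambda>i. {w ! i})"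
      using that by (auto simp: cyl_def PiE_iff extensional_def)
    then show ?thesis by (auto intro!: sets_PiM_I_finite)
  qed
  have C: "emeasure (IT.C 0 (length w) (\<lambda>_. undefined)) (cyl (length w) w) = ennreal (markov_measure \<pi> P w)" for w
  proof (induction w rule: rev_induct)
    case Nil
    then show ?case
      using cyl_sets[of "[]" 0]
      by (simp add: markov_measure_def cyl_def)
  next
    case (snoc a w)
    let ?n = "length w" and ?C = "IT.C 0 (length w) (\<lambda>_. undefined)"
    let ?p = "if w = [] then \<pi> a else P (last w) a"
    have sp: "space ?C = space (PiM {0..<?n} (\<lambda>_. count_space UNIV))"
      using IT.space_C[of "\<lambda>_. undefined" 0 ?n] by simp
    have "emeasure (?C \<bind> IT.eP ?n) (cyl (Suc ?n) (w @ [a]))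
        = (\<integral>\<^sup>+x. emeasure (IT.eP ?n x) (cyl (Suc ?n) (w @ [a])) \<partial>?C)"
      using IT.space_PiM_not_empty cyl_sets[of "w @ [a]" "Suc ?n"] IT.measurable_eP[of ?n]
      by (intro emeasure_bind) (auto simp: sp space_PiM PiE_eq_empty_iff measurable_cong_sets[OF IT.sets_C[of _ 0, simplified] refl])
    also have "\<dots> = (\<integral>\<^sup>+x. ennreal ?p * indicator (cyl ?n w) x \<partial>?C)"
    proof (rule nn_integral_cong)
      fix x assume x: "x \<in> space ?C"
      have "emeasure (IT.eP ?n x) (cyl (Suc ?n) (w @ [a])) = emeasure (K ?n x) {b. x(?n := b) \<in> cyl (Suc ?n) (w @ [a])}"
        using x cyl_sets[of "w @ [a]" "Suc ?n"] by (subst IT.emeasure_eP) (auto simp: sp vimage_def)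
      also have "{b. x(?n := b) \<in> cyl (Suc ?n) (w @ [a])} = (if x \<in> cyl ?n w then {a} else {})"
        using x by (auto simp: sp cyl_def space_PiM PiE_iff extensional_def nth_append less_Suc_eq)
      also have "emeasure (K ?n x) \<dots> = ennreal ?p * indicator (cyl ?n w) x"
        by (auto simp: em cyl_def last_conv_nth)
      finally show "emeasure (IT.eP ?n x) (cyl (Suc ?n) (w @ [a])) = ennreal ?p * indicator (cyl ?n w) x" .
    qed
    also have "\<dots> = ennreal ?p * emeasure ?C (cyl ?n w)"
      using cyl_sets[of w ?n] IT.sets_C[of "\<lambda>_. undefined" 0 ?n]
      by (intro nn_integral_cmult_indicator) auto
    also have "\<dots> = ennreal (markov_measure \<pi> P (w @ [a]))"
      using mc markov_measure_nonneg[OF mc, of w]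
      by (simp only: snoc.IH markov_measure_snoc)
        (auto simp: markov_chain_def ennreal_mult mult.commute)
    finally show ?case by simp
  qed
  let ?B = "IT.PF.lim"
  have sets: "sets ?B = sets (\<Pi>\<^sub>M i\<in>UNIV. count_space UNIV)"
    by simp
  have cyl: "emeasure ?B (cylinder w) = ennreal (markov_measure \<pi> P w)" for w
  proof -
    let ?n = "length w"
    have "cylinder w = prod_emb UNIV (\<lambda>_. count_space UNIV) {0..<?n} (cyl ?n w)"
      by (auto simp: cylinder_def cyl_def prod_emb_def space_PiM)
    then have "emeasure ?B (cylinder w) = emeasure (IT.CI {0..<?n}) (cyl ?n w)"
      using cyl_sets[of w ?n] by (simp add: IT.lim)
    also have "\<dots> = emeasure (IT.C 0 ?n (\<lambda>_. undefined)) (prod_emb {0..<?n} (\<lambda>_. count_space UNIV) {0..<?n} (cyl ?n w))"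
      using cyl_sets[of w ?n] by (intro IT.emeasure_CI) auto
    also have "\<dots> = ennreal (markov_measure \<pi> P w)"
      using C[of w] by (subst prod_emb_id) (auto simp: cyl_def PiE_iff extensional_def)
    finally show ?thesis .
  qed
  have "prob_space ?B"
  proof
    have "space ?B = cylinder []" by (simp add: cylinder_def space_PiM)
    with cyl[of "[]"] show "emeasure ?B (space ?B) = 1" by (simp add: markov_measure_def)
  qed
  moreover have "measure ?B (cylinder w) = markov_measure \<pi> P w" for w
    using cyl[of w] markov_measure_nonneg[OF mc, of w] by (simp add: measure_def)
  ultimately show ?thesis
    using sets by blast
qed

lemma path_measure:
  fixes \<pi> :: "'s::finite \<Rightarrow> real"
  assumes "markov_chain \<pi> P"
  shows "sets (path_measure \<pi> P) = sets (\<Pi>\<^sub>M i\<in>UNIV. count_space UNIV) \<and> prob_space (path_measure \<pi> P) \<and>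
    (\<forall>w. measure (path_measure \<pi> P) (cylinder w) = markov_measure \<pi> P w)"
  unfolding path_measure_def
proof (rule theI')
  show "\<exists>!B. sets B = sets (\<Pi>\<^sub>M i\<in>UNIV. count_space UNIV) \<and> prob_space B \<and>
      (\<forall>w. measure B (cylinder w) = markov_measure \<pi> P w)"
    using path_measure_exists[OF assms] by (rule ex_ex1I) (auto intro!: eq_measure_cylinder)
qed

end

theory Submission
  imports Defs
begin

text \<open>
  Write \<open>m\<close> for the Markov measure. For a letter \<open>b\<close> let \<open>m_b(w) = m(w b) / \<pi>(b)\<close>; this is the
  weight of \<open>w\<close> as a possible past of \<open>b\<close>, and \<open>m(w) = \<Sum>b. \<pi>(b) m_b(w)\<close>. Let
  \<open>p(b,a) = \<pi>(a) P(a,b) / \<pi>(b)\<close> be the reversed chain. A finite subtree of the left Cayley graph that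
  contains the identity is a finite suffix-closed set of words, so the supremum of
  \<open>\<Sum>w\<in>\<tau>. h(w x) m_b(w)\<close> over the subtrees of height less than \<open>n\<close>, the empty one included, obeys the
  optimal stopping recursion
  \<open>V\<^sub>n\<^sub>+\<^sub>1(b,x) = max 0 (h(x) + \<Sum>a. p(b,a) V\<^sub>n(a, a x))\<close>: each child of the root is either left out
  or carries an optimal tree of its own.

  The averages over trees converge to the conditional expectation \<open>g\<close> of \<open>f\<close> if, for every
  \<open>\<epsilon> > 0\<close> and almost every \<open>x\<close>, the tree sums of \<open>h = f - g - \<epsilon>\<close> are bounded above by a constant
  depending on \<open>x\<close> only, and likewise for \<open>-f\<close> and \<open>-g\<close>: after division by \<open>m(\<tau>)\<close> the constant
  disappears in the limit. Thus the claim is that \<open>D_b = {x. sup\<^sub>n V\<^sub>n(b,x) = \<infinity>}\<close> is null.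

  Three observations give this. First, Garsia's proof of the maximal ergodic theorem applies verbatim to
  the recursion above, since the averaging operator of the reversed chain is positive and preserves
  the integral: \<open>\<Sum>b. \<pi>(b) \<integral> h\<close> over \<open>{V\<^sub>n(b,\<cdot>) > 0}\<close> is nonnegative
  (\<open>garsia\<close>, \<open>maximal_inequality\<close>). Second, \<open>a x \<in> D_a\<close> implies \<open>x \<in> D_b\<close> whenever \<open>P(a,b) > 0\<close>, and
  the preservation of the integral turns this implication into an equivalence almost everywhere
  (\<open>unbounded_gain_invariant\<close>). Third, weak mixing forces the sets \<open>D_b\<close> to coincide up to null sets.
  Indeed, consider the partition of the letters by the class of \<open>D_b\<close> modulo null sets. The second observation
  makes it compatible with \<open>P\<close> in such a way that, if it had more than one part, the free group would act by
  permutations on the finite set of parts, and the pairs \<open>(y, q)\<close> for which \<open>q\<close> is the part of the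
  first letter of \<open>y\<close> would form, up to a null set, an invariant set that is neither null nor
  conull in the product of the boundary with an orbit (\<open>weakly_mixing_coloring_constant\<close>). With the
  uniform measure such an orbit is an ergodic probability-measure-preserving action, so this contradicts weak
  mixing.

  The common set \<open>D\<close> is then invariant, the maximal inequality gives
  \<open>0 \<le> \<integral> h\<close> over \<open>D\<close>, and this integral equals \<open>-\<epsilon> \<mu>(D)\<close> because \<open>f\<close> and \<open>g\<close> have the same integral
  over invariant sets. Hence \<open>\<mu>(D) = 0\<close> (\<open>AE_bounded_gain\<close>).
\<close>

section \<open>The maximal ergodic theorem for trees\<close>

text \<open>The largest total gain that a tree of height less than \<open>n\<close> hanging at \<open>x\<close> can have, where the
  empty tree gains nothing and the branch of \<open>a\<close> below a point of type \<open>b\<close> is discounted by \<open>p b a\<close>.\<close>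

primrec best :: "('s::finite \<Rightarrow> 's \<Rightarrow> real) \<Rightarrow> ('s \<Rightarrow> 'x \<Rightarrow> 'x) \<Rightarrow> ('x \<Rightarrow> real) \<Rightarrow> nat \<Rightarrow> 's \<Rightarrow> 'x \<Rightarrow> real" where
  "best p T h 0 = (\<lambda>b x. 0)"
| "best p T h (Suc n) = (\<lambda>b x. max 0 (h x + (\<Sum>a\<in>UNIV. p b a * best p T h n a (T a x))))"

lemma best_nonneg: "0 \<le> best p T h n b x"
  by (cases n) auto

lemma best_mono_Suc:
  assumes "\<And>b a. 0 \<le> p b a"
  shows "best p T h n b x \<le> best p T h (Suc n) b x"
proof (induction n arbitrary: b x)
  case (Suc n)
  have "(\<Sum>a\<in>UNIV. p b a * best p T h n a (T a x)) \<le> (\<Sum>a\<in>UNIV. p b a * best p T h (Suc n) a (T a x))"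
    by (intro sum_mono mult_left_mono Suc.IH assms)
  then show ?case by simp
qed simp

lemma best_mono:
  assumes "\<And>b a. 0 \<le> p b a" and "m \<le> n"
  shows "best p T h m b x \<le> best p T h n b x"
  using lift_Suc_mono_le[of "\<lambda>n. best p T h n b x", OF best_mono_Suc[OF assms(1)] assms(2)] .

text \<open>Restricting the gain to an invariant set commutes with taking the best tree, because
  the points of a tree lie either all inside the set or all outside.\<close>

lemma best_indicator:
  assumes A: "\<And>a x. x \<in> S \<Longrightarrow> T a x \<in> S" "\<And>a x. x \<in> S \<Longrightarrow> T a x \<in> A \<longleftrightarrow> x \<in> A" and "x \<in> S"
  shows "best p T (\<lambda>x. indicator A x * h x) n b x = indicator A x * best p T h n b x"
  using \<open>x \<in> S\<close>
proof (induction n arbitrary: b x)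
  case (Suc n)
  then show ?case
    using A by (cases "x \<in> A") (auto simp: indicator_def)
qed simp

definition unbounded_gain :: "('s::finite \<Rightarrow> 's \<Rightarrow> real) \<Rightarrow> ('s \<Rightarrow> 'x \<Rightarrow> 'x) \<Rightarrow> ('x \<Rightarrow> real) \<Rightarrow> 's \<Rightarrow> 'x set" where
  "unbounded_gain p T h b = {x. \<forall>C::nat. \<exists>n. real C < best p T h n b x}"

lemma bounded_gain:
  assumes "x \<notin> unbounded_gain p T h b"
  shows "\<exists>C. \<forall>n. best p T h n b x \<le> C"
  using assms by (force simp: unbounded_gain_def not_less)

text \<open>A tree below \<open>T a x\<close> with large gain becomes, after attaching the root \<open>x\<close>, a tree whose gain
  is large as well, since the factor \<open>p b a\<close> and the summand \<open>h x\<close> are fixed.\<close>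

lemma unbounded_gain_step:
  assumes p: "\<And>b a. 0 \<le> p b a" and pos: "0 < p b a" and Tx: "T a x \<in> unbounded_gain p T h a"
  shows "x \<in> unbounded_gain p T h b"
  unfolding unbounded_gain_def
proof (intro CollectI allI)
  fix C :: nat
  obtain N :: nat where N: "(real C - h x) / p b a < N"
    using reals_Archimedean2 by blast
  obtain n where "real N < best p T h n a (T a x)"
    using Tx by (auto simp: unbounded_gain_def)
  with N have "(real C - h x) / p b a < best p T h n a (T a x)" by simp
  then have "real C - h x < p b a * best p T h n a (T a x)"
    using pos by (simp add: divide_less_eq mult.commute)
  also have "\<dots> \<le> (\<Sum>a\<in>UNIV. p b a * best p T h n a (T a x))"
    by (rule member_le_sum) (auto simp: p best_nonneg)
  finally have "real C < best p T h (Suc n) b x" by simp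
  then show "\<exists>n. real C < best p T h n b x" ..
qed

text \<open>A stationary chain of random measure-preserving maps: from a point of type \<open>b\<close> the map \<open>T a\<close> is applied
  with probability \<open>p b a\<close>, and the type becomes \<open>a\<close>. The product of \<open>\<rho>\<close> and the measure is then stationary.\<close>

locale random_maps = prob_space M
  for M :: "'x measure" and T :: "'s::finite \<Rightarrow> 'x \<Rightarrow> 'x" and \<rho> :: "'s \<Rightarrow> real" and p :: "'s \<Rightarrow> 's \<Rightarrow> real" +
  assumes T_measurable [measurable]: "\<And>a. T a \<in> measurable M M"
    and T_preserving: "\<And>a. distr M M (T a) = M"
    and p_nonneg: "\<And>b a. 0 \<le> p b a"
    and p_sum: "\<And>b. (\<Sum>a\<in>UNIV. p b a) = 1"
    and \<rho>_pos: "\<And>b. 0 < \<rho> b"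
    and \<rho>_stationary: "\<And>a. (\<Sum>b\<in>UNIV. \<rho> b * p b a) = \<rho> a"
begin

lemma AE_T: "(AE x in M. R (T a x))" if "AE x in M. R x"
proof (rule AE_distrD[OF T_measurable])
  show "AE x in distr M M (T a). R x"
    unfolding T_preserving by (rule that)
qed

lemma integrable_T:
  fixes g :: "'x \<Rightarrow> real"
  assumes "integrable M g" shows "integrable M (\<lambda>x. g (T a x))"
  by (rule integrable_distr[OF T_measurable]) (simp add: T_preserving assms)

lemma integral_T:
  fixes g :: "'x \<Rightarrow> real"
  assumes "integrable M g" shows "(\<integral>x. g (T a x) \<partial>M) = (\<integral>x. g x \<partial>M)"
  using integral_distr[OF T_measurable[of a] borel_measurable_integrable[OF assms]] by (simp add: T_preserving)

lemma integral_transfer: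
  fixes g :: "'s \<Rightarrow> 'x \<Rightarrow> real"
  assumes g: "\<And>a. integrable M (g a)"
  shows "(\<Sum>b\<in>UNIV. \<rho> b * (\<integral>x. (\<Sum>a\<in>UNIV. p b a * g a (T a x)) \<partial>M)) = (\<Sum>b\<in>UNIV. \<rho> b * (\<integral>x. g b x \<partial>M))"
proof -
  have "(\<integral>x. (\<Sum>a\<in>UNIV. p b a * g a (T a x)) \<partial>M) = (\<Sum>a\<in>UNIV. p b a * (\<integral>x. g a x \<partial>M))" for b
    using g by (simp add: integral_T integrable_T)
  then have "(\<Sum>b\<in>UNIV. \<rho> b * (\<integral>x. (\<Sum>a\<in>UNIV. p b a * g a (T a x)) \<partial>M))
      = (\<Sum>b\<in>UNIV. \<Sum>a\<in>UNIV. (\<rho> b * p b a) * (\<integral>x. g a x \<partial>M))"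
    by (simp add: sum_distrib_left mult.assoc)
  also have "\<dots> = (\<Sum>a\<in>UNIV. \<rho> a * (\<integral>x. g a x \<partial>M))"
    by (subst sum.swap) (simp add: sum_distrib_right[symmetric] \<rho>_stationary)
  finally show ?thesis .
qed

lemma best_measurable [measurable]:
  assumes [measurable]: "h \<in> borel_measurable M"
  shows "best p T h n b \<in> borel_measurable M"
  by (induction n arbitrary: b) simp_all

lemma best_integrable:
  assumes "integrable M h"
  shows "integrable M (best p T h n b)"
proof (induction n arbitrary: b)
  case (Suc n)
  then show ?case
    using assms by (auto intro!: integrable_max Bochner_Integration.integrable_sum integrable_T)
qed simp

text \<open>Garsia's argument. Where the gain \<open>V\<^sub>k\<^sub>+\<^sub>1\<close> is positive, \<open>h = V\<^sub>k\<^sub>+\<^sub>1 - Q V\<^sub>k \<ge> V\<^sub>k - Q V\<^sub>k\<close>, where \<open>Q\<close> is the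
  averaging operator of the chain; elsewhere \<open>V\<^sub>k = 0\<close> and \<open>Q V\<^sub>k \<ge> 0\<close>, so the lower bound
  \<open>V\<^sub>k - Q V\<^sub>k\<close> remains valid. Its integral vanishes by stationarity.\<close>

lemma garsia:
  assumes h: "integrable M h"
  shows "0 \<le> (\<Sum>b\<in>UNIV. \<rho> b * (\<integral>x. indicator {x. 0 < best p T h n b x} x * h x \<partial>M))"
proof (cases n)
  case (Suc k)
  have [measurable]: "h \<in> borel_measurable M" using h by simp
  let ?V = "best p T h"
  let ?Q = "\<lambda>b x. \<Sum>a\<in>UNIV. p b a * ?V k a (T a x)"
  have Q: "integrable M (?Q b)" for b
    by (intro Bochner_Integration.integrable_sum integrable_mult_right integrable_T best_integrable h)
  have ind: "integrable M (\<lambda>x. indicator {x. 0 < ?V n b x} x * h x)" for b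
    by (rule Bochner_Integration.integrable_bound[OF h]) (auto simp: indicator_def)
  have "?V k b x - ?Q b x \<le> indicator {x. 0 < ?V n b x} x * h x" for b x
  proof -
    have "0 \<le> ?Q b x" by (intro sum_nonneg mult_nonneg_nonneg p_nonneg best_nonneg)
    moreover have "?V k b x \<le> ?V n b x" using best_mono_Suc[OF p_nonneg] Suc by simp
    ultimately show ?thesis by (auto simp: Suc indicator_def max_def split: if_splits)
  qed
  then have "(\<integral>x. ?V k b x - ?Q b x \<partial>M) \<le> (\<integral>x. indicator {x. 0 < ?V n b x} x * h x \<partial>M)" for b
    by (intro integral_mono Bochner_Integration.integrable_diff best_integrable h Q ind)
  then have "(\<Sum>b\<in>UNIV. \<rho> b * (\<integral>x. ?V k b x - ?Q b x \<partial>M)) \<le> (\<Sum>b\<in>UNIV. \<rho> b * (\<integral>x. indicator {x. 0 < ?V n b x} x * h x \<partial>M))"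
    by (intro sum_mono mult_left_mono) (auto simp: less_imp_le[OF \<rho>_pos])
  moreover have "(\<Sum>b\<in>UNIV. \<rho> b * (\<integral>x. ?V k b x - ?Q b x \<partial>M)) = 0"
  proof -
    have "(\<Sum>b\<in>UNIV. \<rho> b * (\<integral>x. ?V k b x - ?Q b x \<partial>M))
        = (\<Sum>b\<in>UNIV. \<rho> b * (\<integral>x. ?V k b x \<partial>M)) - (\<Sum>b\<in>UNIV. \<rho> b * (\<integral>x. ?Q b x \<partial>M))"
      by (subst Bochner_Integration.integral_diff[OF best_integrable[OF h] Q])
        (simp only: right_diff_distrib sum_subtractf)
    then show ?thesis using integral_transfer[of "?V k", OF best_integrable[OF h]] by simp
  qed
  ultimately show ?thesis by simp
qed simp

text \<open>On an invariant set where the gain is unbounded, the sets in Garsia's inequality for the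
  restriction of \<open>h\<close> exhaust the set.\<close>

lemma maximal_inequality:
  assumes h: "integrable M h" and A: "A \<in> sets M"
    and inv: "\<And>a x. x \<in> space M \<Longrightarrow> T a x \<in> A \<longleftrightarrow> x \<in> A"
    and sub: "\<And>b. A \<subseteq> unbounded_gain p T h b"
  shows "0 \<le> (\<integral>x. indicator A x * h x \<partial>M)"
proof -
  have [measurable]: "h \<in> borel_measurable M" "A \<in> sets M" using h A by simp_all
  let ?h = "\<lambda>x. indicator A x * h x"
  have h': "integrable M ?h"
    by (rule Bochner_Integration.integrable_bound[OF h]) (auto simp: indicator_def)
  have [measurable]: "?h \<in> borel_measurable M" by simp
  have lim: "(\<lambda>n. \<integral>x. indicator {x. 0 < best p T ?h n b x} x * ?h x \<partial>M) \<longlonglongrightarrow> (\<integral>x. ?h x \<partial>M)" for b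
  proof (rule integral_dominated_convergence[OF _ _ h'[THEN integrable_norm]])
    have "(\<lambda>n. indicator {x. 0 < best p T ?h n b x} x * ?h x) \<longlonglongrightarrow> ?h x" if x: "x \<in> space M" for x
    proof (cases "x \<in> A")
      case True
      then obtain m where "real 0 < best p T h m b x"
        using sub[of b] unfolding unbounded_gain_def by blast
      then have "0 < best p T ?h n b x" if "m \<le> n" for n
        using best_mono[where p = p, OF p_nonneg that, where T = T and h = h and b = b and x = x] True
          best_indicator[where T = T and p = p and h = h and n = n and b = b, OF measurable_space[OF T_measurable] inv x] by simp
      then have "eventually (\<lambda>n. indicator {x. 0 < best p T ?h n b x} x * ?h x = ?h x) sequentially"
        by (auto simp: eventually_sequentially intro!: exI[of _ m])
      then show ?thesis by (rule tendsto_eventually)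
    qed simp
    then show "AE x in M. (\<lambda>n. indicator {x. 0 < best p T ?h n b x} x * ?h x) \<longlonglongrightarrow> ?h x"
      by simp
  qed (auto simp: indicator_def)
  have "(\<lambda>n. \<Sum>b\<in>UNIV. \<rho> b * (\<integral>x. indicator {x. 0 < best p T ?h n b x} x * ?h x \<partial>M))
      \<longlonglongrightarrow> (\<Sum>b\<in>UNIV. \<rho> b * (\<integral>x. ?h x \<partial>M))"
    by (intro tendsto_sum tendsto_mult tendsto_const lim)
  then have "0 \<le> (\<Sum>b\<in>UNIV. \<rho> b * (\<integral>x. ?h x \<partial>M))"
    by (rule LIMSEQ_le_const) (use garsia[OF h'] in auto)
  also have "\<dots> = (\<Sum>b\<in>UNIV. \<rho> b) * (\<integral>x. ?h x \<partial>M)"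
    by (simp add: sum_distrib_right)
  finally show ?thesis
    using sum_pos[of UNIV \<rho>] \<rho>_pos by (simp add: zero_le_mult_iff)
qed

lemma unbounded_gain_sets [measurable]:
  assumes [measurable]: "h \<in> borel_measurable M"
  shows "Measurable.pred M (\<lambda>x. x \<in> unbounded_gain p T h b)"
  by (simp add: unbounded_gain_def)

text \<open>By \<open>unbounded_gain_step\<close> the indicator \<open>g\<close> of unbounded gain dominates its average \<open>Q g\<close> over the next
  step. Both have the same integral, so they agree almost everywhere, and an average of numbers at
  most 1 can equal 1 only if all those of positive weight do.\<close>

lemma unbounded_gain_invariant:
  assumes [measurable]: "h \<in> borel_measurable M"
  shows "AE x in M. \<forall>b a. 0 < p b a \<longrightarrow> (x \<in> unbounded_gain p T h b \<longleftrightarrow> T a x \<in> unbounded_gain p T h a)"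
proof -
  define g :: "'s \<Rightarrow> 'x \<Rightarrow> real" where "g b = indicator (unbounded_gain p T h b)" for b
  have [measurable]: "g b \<in> borel_measurable M" for b
    by (simp add: g_def)
  have g: "integrable M (g b)" for b
    by (rule integrable_const_bound[of _ 1]) (auto simp: g_def)
  let ?Q = "\<lambda>b x. \<Sum>a\<in>UNIV. p b a * g a (T a x)"
  have Q: "integrable M (?Q b)" for b
    by (intro Bochner_Integration.integrable_sum integrable_mult_right integrable_T g)
  have Q_le: "?Q b x \<le> g b x" for b x
  proof (cases "x \<in> unbounded_gain p T h b")
    case True
    have "?Q b x \<le> (\<Sum>a\<in>UNIV. p b a * 1)"
      by (intro sum_mono mult_left_mono p_nonneg) (simp add: g_def indicator_def)
    with True show ?thesis by (simp add: p_sum g_def)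
  next
    case False
    then have "p b a * g a (T a x) = 0" for a
      using unbounded_gain_step[OF p_nonneg, where b = b and a = a and x = x] p_nonneg[of b a] by (auto simp: g_def indicator_def)
    then have "?Q b x = 0" by (intro sum.neutral) simp
    then show ?thesis using False by (simp add: g_def)
  qed
  have nn: "0 \<le> \<rho> b * (\<integral>x. g b x - ?Q b x \<partial>M)" for b
    using Q_le \<rho>_pos[of b] by (intro mult_nonneg_nonneg integral_nonneg_AE) auto
  have "(\<Sum>b\<in>UNIV. \<rho> b * (\<integral>x. g b x - ?Q b x \<partial>M))
      = (\<Sum>b\<in>UNIV. \<rho> b * (\<integral>x. g b x \<partial>M)) - (\<Sum>b\<in>UNIV. \<rho> b * (\<integral>x. ?Q b x \<partial>M))"
    by (subst Bochner_Integration.integral_diff[OF g Q]) (simp only: right_diff_distrib sum_subtractf)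
  also have "\<dots> = 0" using integral_transfer[of g, OF g] by simp
  finally have zero: "\<rho> b * (\<integral>x. g b x - ?Q b x \<partial>M) = 0" for b
    using nn by (subst (asm) sum_nonneg_eq_0_iff) auto
  have "(\<integral>x. g b x - ?Q b x \<partial>M) = 0" for b
    using zero[of b] \<rho>_pos[of b] by simp
  then have "AE x in M. g b x - ?Q b x = 0" for b
    using Q_le g Q by (subst (asm) integral_nonneg_eq_0_iff_AE) auto
  then have "AE x in M. \<forall>b. g b x - ?Q b x = 0"
    by (simp add: AE_all_countable)
  then show ?thesis
  proof eventually_elim
    case (elim x)
    show ?case
    proof (intro allI impI iffI)
      fix b a assume pos: "0 < p b a"
      show "x \<in> unbounded_gain p T h b" if "T a x \<in> unbounded_gain p T h a"
        using unbounded_gain_step[OF p_nonneg pos that] .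
      assume x: "x \<in> unbounded_gain p T h b"
      have "g b x = (\<Sum>a\<in>UNIV. p b a)" using x by (simp add: g_def p_sum)
      moreover have "g b x - ?Q b x = 0" using elim by blast
      ultimately have "?Q b x = (\<Sum>a\<in>UNIV. p b a)" by linarith
      then have "(\<Sum>a\<in>UNIV. p b a * (1 - g a (T a x))) = 0"
        by (simp add: right_diff_distrib sum_subtractf)
      moreover have "0 \<le> p b a * (1 - g a (T a x))" for a
        by (intro mult_nonneg_nonneg p_nonneg) (simp add: g_def indicator_def)
      ultimately have "p b a * (1 - g a (T a x)) = 0"
        by (subst (asm) sum_nonneg_eq_0_iff) auto
      with pos show "T a x \<in> unbounded_gain p T h a"
        by (auto simp: g_def indicator_def split: if_splits)
    qed
  qed
qed

end

section \<open>Subtrees of the Cayley graph as optimal stopping\<close>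

definition suffix_closed :: "'a list set \<Rightarrow> bool" where
  "suffix_closed \<tau> \<longleftrightarrow> (\<forall>a w. a # w \<in> \<tau> \<longrightarrow> w \<in> \<tau>)"

text \<open>A path from \<open>a # w\<close> to the identity has to leave the set of words with suffix \<open>a # w\<close>, and the only
  edge leaving this set leads from \<open>a # w\<close> to \<open>w\<close>.\<close>

lemma suffix_closed_subtree:
  assumes \<tau>: "cayley_subtree \<tau>" and one: "[] \<in> \<tau>"
  shows "suffix_closed \<tau>"
  unfolding suffix_closed_def
proof (intro allI impI, rule ccontr)
  fix a w assume aw: "a # w \<in> \<tau>" and w: "w \<notin> \<tau>"
  have "(a # w, []) \<in> (cayley_edges \<inter> \<tau> \<times> \<tau>)\<^sup>*"
    using \<tau> one aw by (auto simp: cayley_subtree_def)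
  then have "\<exists>u. [] = u @ a # w"
  proof (induction rule: rtrancl_induct)
    case (step v v')
    then obtain c u where v: "v = u @ a # w" and c: "v' = push c v" and "v' \<in> \<tau>"
      by (auto simp: cayley_edges_def mult_free_group)
    show ?case
    proof (cases u)
      case Nil
      then have "v' = w \<or> v' = [c] @ a # w" using v c by auto
      then show ?thesis using w \<open>v' \<in> \<tau>\<close> by blast
    next
      case (Cons d u')
      then have "v' = u' @ a # w \<or> v' = (c # u) @ a # w" using v c by auto
      then show ?thesis by blast
    qed
  qed simp
  then show False by simp
qed

text \<open>The transition matrix of the time reversal of the stationary chain.\<close>

definition reversal :: "('s \<Rightarrow> real) \<Rightarrow> ('s \<Rightarrow> 's \<Rightarrow> real) \<Rightarrow> 's \<Rightarrow> 's \<Rightarrow> real" where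
  "reversal \<pi> P b a = \<pi> a * P a b / \<pi> b"

lemma reversal_nonneg: "markov_chain \<pi> P \<Longrightarrow> 0 \<le> reversal \<pi> P b a"
  by (simp add: reversal_def markov_chain_def)

text \<open>The conditional probability of \<open>w\<close> preceding the letter \<open>b\<close> in the stationary chain. Conditioning on the
  next letter makes the weight multiplicative along the branches of the tree, which
  \<open>markov_measure\<close> itself is not.\<close>

definition weight_before :: "('s \<Rightarrow> real) \<Rightarrow> ('s \<Rightarrow> 's \<Rightarrow> real) \<Rightarrow> 's \<Rightarrow> 's list \<Rightarrow> real" where
  "weight_before \<pi> P b w = markov_measure \<pi> P (w @ [b]) / \<pi> b"

lemma weight_before_Nil: "\<pi> b \<noteq> 0 \<Longrightarrow> weight_before \<pi> P b [] = 1"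
  by (simp add: weight_before_def markov_measure_def)

lemma weight_before_snoc:
  assumes "\<pi> a \<noteq> 0"
  shows "weight_before \<pi> P b (w @ [a]) = reversal \<pi> P b a * weight_before \<pi> P a w"
  using assms markov_measure_snoc[of \<pi> P "w @ [a]" b]
  by (simp add: weight_before_def reversal_def)

lemma sum_weight_before:
  fixes \<pi> :: "'s::finite \<Rightarrow> real"
  assumes mc: "markov_chain \<pi> P" and pos: "\<forall>a. 0 < \<pi> a"
  shows "(\<Sum>b\<in>UNIV. \<pi> b * weight_before \<pi> P b w) = markov_measure \<pi> P w"
proof -
  have "\<pi> b * weight_before \<pi> P b w = markov_measure \<pi> P w * (if w = [] then \<pi> b else P (last w) b)" for b
    using pos[rule_format, of b] by (simp add: weight_before_def markov_measure_snoc)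
  then have "(\<Sum>b\<in>UNIV. \<pi> b * weight_before \<pi> P b w)
      = markov_measure \<pi> P w * (\<Sum>b\<in>UNIV. if w = [] then \<pi> b else P (last w) b)"
    by (simp add: sum_distrib_left)
  also have "\<dots> = markov_measure \<pi> P w"
    using mc by (cases "w = []") (auto simp: markov_chain_def)
  finally show ?thesis .
qed

lemma action_snoc:
  assumes "group_action free_group S \<alpha>" "x \<in> S" "reduced_word (u @ [a])"
  shows "\<alpha> (u @ [a]) x = \<alpha> u (\<alpha> [a] x)"
proof -
  interpret group_action free_group S \<alpha> by fact
  have u: "reduced_word u" and a: "reduced_word [a]"
    using assms(3) by (auto simp: reduced_word_def successively_append_iff)
  have "u @ [a] = u \<otimes>\<^bsub>free_group\<^esub> [a]"
    using assms(3) by (simp add: free_group_def reduce_reduced)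
  then show ?thesis
    using composition_rule[OF assms(2), of u "[a]"] u a by simp
qed

lemma action_Nil:
  assumes "group_action free_group S \<alpha>" "x \<in> S"
  shows "\<alpha> [] x = x"
proof -
  interpret group_action free_group S \<alpha> by fact
  show ?thesis using id_eq_one assms(2) by (metis one_free_group restrict_apply')
qed

text \<open>A nonempty suffix-closed set consists of its root, the empty word, and for each letter \<open>a\<close> of the
  words \<open>u @ [a]\<close> with \<open>u\<close> in a smaller suffix-closed set. Such a word acts on \<open>x\<close> as \<open>u\<close> acts on
  the translate of \<open>x\<close> by \<open>a\<close>, so the induction hypothesis applies at that point.\<close>

lemma tree_sum_le_best:
  fixes \<pi> :: "'g::finite letter \<Rightarrow> real"
  assumes act: "group_action free_group S \<alpha>"
    and mc: "markov_chain \<pi> P" and pos: "\<forall>a. 0 < \<pi> a"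
    and "finite \<tau>" "suffix_closed \<tau>" "\<tau> \<subseteq> {w. reduced_word w}" "\<forall>w\<in>\<tau>. length w < n" "x \<in> S"
  shows "(\<Sum>w\<in>\<tau>. h (\<alpha> w x) * weight_before \<pi> P b w) \<le> best (reversal \<pi> P) (\<lambda>a. \<alpha> [a]) h n b x"
  using assms(4-)
proof (induction n arbitrary: \<tau> b x)
  case 0
  then have "\<tau> = {}" by auto
  then show ?case by simp
next
  case (Suc n)
  have nz: "\<pi> a \<noteq> 0" for a using pos[rule_format, of a] by simp
  show ?case
  proof (cases "\<tau> = {}")
    case True
    then show ?thesis by (simp add: best_nonneg del: best.simps)
  next
    case False
    have "[] \<in> \<tau>" if "w \<in> \<tau>" for w
      using that Suc.prems(2) by (induction w) (auto simp: suffix_closed_def)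
    with False have one: "[] \<in> \<tau>" by auto
    let ?g = "\<lambda>w. h (\<alpha> w x) * weight_before \<pi> P b w"
    define \<sigma> where "\<sigma> a = {u. u @ [a] \<in> \<tau>}" for a
    have fin: "finite (\<sigma> a)" for a
      unfolding \<sigma>_def using finite_vimageI[OF Suc.prems(1), of "\<lambda>u. u @ [a]"]
      by (simp add: inj_on_def vimage_def)
    have sub: "\<alpha> [a] x \<in> S" for a
      using group_action.element_image[OF act, of "[a]" x] Suc.prems(5) by (simp add: reduced_Cons)
    have bij: "bij_betw (\<lambda>(a, u). u @ [a]) (SIGMA a:UNIV. \<sigma> a) (\<tau> - {[]})"
      unfolding bij_betw_def
    proof (intro conjI equalityI subsetI)
      fix w assume w: "w \<in> \<tau> - {[]}"
      then have "w = (\<lambda>(a, u). u @ [a]) (last w, butlast w)" by simp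
      moreover have "(last w, butlast w) \<in> (SIGMA a:UNIV. \<sigma> a)" using w by (simp add: \<sigma>_def)
      ultimately show "w \<in> (\<lambda>(a, u). u @ [a]) ` (SIGMA a:UNIV. \<sigma> a)" by (rule image_eqI)
    qed (auto simp: inj_on_def \<sigma>_def)
    have root: "(\<Sum>w\<in>\<tau>. ?g w) = ?g [] + (\<Sum>w\<in>\<tau> - {[]}. ?g w)"
      by (rule sum.remove[OF Suc.prems(1) one])
    have "(\<Sum>w\<in>\<tau> - {[]}. ?g w) = (\<Sum>(a, u)\<in>(SIGMA a:UNIV. \<sigma> a). ?g (u @ [a]))"
      by (subst sum.reindex_bij_betw[OF bij, symmetric]) (simp add: case_prod_unfold)
    also have "\<dots> = (\<Sum>a\<in>UNIV. \<Sum>u\<in>\<sigma> a. ?g (u @ [a]))"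
      by (subst sum.Sigma) (auto simp: fin)
    also have "\<dots> = (\<Sum>a\<in>UNIV. reversal \<pi> P b a * (\<Sum>u\<in>\<sigma> a. h (\<alpha> u (\<alpha> [a] x)) * weight_before \<pi> P a u))"
      unfolding sum_distrib_left
    proof (intro sum.cong refl)
      fix a u assume "u \<in> \<sigma> a"
      then have "reduced_word (u @ [a])" using Suc.prems(3) by (auto simp: \<sigma>_def)
      then show "?g (u @ [a]) = reversal \<pi> P b a * (h (\<alpha> u (\<alpha> [a] x)) * weight_before \<pi> P a u)"
        by (simp add: action_snoc[OF act Suc.prems(5)] weight_before_snoc nz)
    qed
    also have "\<dots> \<le> (\<Sum>a\<in>UNIV. reversal \<pi> P b a * best (reversal \<pi> P) (\<lambda>a. \<alpha> [a]) h n a (\<alpha> [a] x))"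
    proof (intro sum_mono mult_left_mono)
      fix a
      show "0 \<le> reversal \<pi> P b a"
        by (rule reversal_nonneg[OF mc])
      have "reduced_word u" if "u \<in> \<sigma> a" for u
        using that Suc.prems(3) by (force simp: \<sigma>_def reduced_word_def successively_append_iff)
      then show "(\<Sum>u\<in>\<sigma> a. h (\<alpha> u (\<alpha> [a] x)) * weight_before \<pi> P a u)
          \<le> best (reversal \<pi> P) (\<lambda>a. \<alpha> [a]) h n a (\<alpha> [a] x)"
        using Suc.prems(2,4) by (intro Suc.IH fin sub) (auto simp: \<sigma>_def suffix_closed_def)
    qed
    finally have "(\<Sum>w\<in>\<tau> - {[]}. ?g w)
        \<le> (\<Sum>a\<in>UNIV. reversal \<pi> P b a * best (reversal \<pi> P) (\<lambda>a. \<alpha> [a]) h n a (\<alpha> [a] x))" .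
    moreover have "?g [] = h x"
      by (simp add: weight_before_Nil nz action_Nil[OF act Suc.prems(5)])
    ultimately show ?thesis by (simp add: root max.coboundedI2)
  qed
qed

section \<open>Weak mixing and colorings of the letters\<close>

text \<open>First a transposition moves \<open>s\<^sub>1\<close> to \<open>t\<^sub>1\<close>, then another one corrects the image of \<open>s\<^sub>2\<close>; by \<open>eq\<close> it fixes
  \<open>t\<^sub>1\<close> or is trivial.\<close>

lemma permutation_with_two_values:
  assumes "s\<^sub>1 \<in> S" "s\<^sub>2 \<in> S" "t\<^sub>1 \<in> S" "t\<^sub>2 \<in> S" and eq: "s\<^sub>1 = s\<^sub>2 \<longleftrightarrow> t\<^sub>1 = t\<^sub>2"
  obtains p where "p permutes S" "p s\<^sub>1 = t\<^sub>1" "p s\<^sub>2 = t\<^sub>2"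
proof
  let ?q = "Transposition.transpose s\<^sub>1 t\<^sub>1"
  let ?p = "Transposition.transpose (?q s\<^sub>2) t\<^sub>2 \<circ> ?q"
  have q: "?q permutes S" using assms by (intro permutes_swap_id)
  then have "?q s\<^sub>2 \<in> S" using assms by (simp add: permutes_in_image)
  then show "?p permutes S" using assms q by (intro permutes_compose permutes_swap_id)
  show "?p s\<^sub>2 = t\<^sub>2" by simp
  show "?p s\<^sub>1 = t\<^sub>1"
    using eq by (cases "s\<^sub>1 = s\<^sub>2") (auto simp: Transposition.transpose_def)
qed

text \<open>The conditions under which there are permutations \<open>\<theta> a\<close> of the colors such that
  \<open>\<theta> (letter_inv a)\<close> is inverse to \<open>\<theta> a\<close>, and \<open>\<theta> a\<close> maps the color of every successor of
  \<open>a\<close> to the color of \<open>a\<close>. By the first condition the successors of \<open>a\<close> have a single color. By the second, the two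
  prescriptions for \<open>\<theta> a\<close>, coming from \<open>a\<close> and from its inverse, define an injective partial map.\<close>

definition compatible_coloring :: "('g letter \<Rightarrow> 'g letter \<Rightarrow> real) \<Rightarrow> ('g letter \<Rightarrow> 'q) \<Rightarrow> bool" where
  "compatible_coloring P c \<longleftrightarrow>
     (\<forall>a b b'. 0 < P a b \<longrightarrow> 0 < P a b' \<longrightarrow> c b = c b') \<and>
     (\<forall>a b b'. 0 < P a b \<longrightarrow> 0 < P (letter_inv a) b' \<longrightarrow> (c b = c (letter_inv a) \<longleftrightarrow> c b' = c a))"

lemma compatible_coloringD:
  assumes "compatible_coloring P c" and "0 < P a b"
  shows "0 < P a b' \<Longrightarrow> c b = c b'"
    and "0 < P (letter_inv a) b' \<Longrightarrow> c b = c (letter_inv a) \<longleftrightarrow> c b' = c a"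
  using assms unfolding compatible_coloring_def by blast+

lemma markov_chain_successor:
  assumes "markov_chain \<pi> P" shows "\<exists>b. 0 < P a b"
proof (rule ccontr)
  assume "\<nexists>b. 0 < P a b"
  then have "P a b = 0" for b
    using assms by (metis markov_chain_def less_eq_real_def)
  moreover have "(\<Sum>b\<in>UNIV. P a b) = 1" using assms by (simp add: markov_chain_def)
  ultimately show False by simp
qed

lemma coloring_permutations:
  fixes c :: "'g letter \<Rightarrow> 'q"
  assumes c: "compatible_coloring P c" and succ: "\<And>a. \<exists>b. 0 < P a b"
  obtains \<theta> where "\<And>a. \<theta> a permutes range c" "\<And>a q. \<theta> (letter_inv a) (\<theta> a q) = q"
    "\<And>a b. 0 < P a b \<Longrightarrow> \<theta> a (c b) = c a"
proof -
  obtain s where s: "\<And>a. 0 < P a (s a)" using succ by metis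
  have s_eq: "c b = c (s a)" if "0 < P a b" for a b
    using compatible_coloringD(1)[OF c that s] .
  have "\<exists>p. p permutes range c \<and> p (c (s (g, True))) = c (g, True) \<and> p (c (g, False)) = c (s (g, False))" for g
  proof -
    have "c (s (g, True)) = c (g, False) \<longleftrightarrow> c (g, True) = c (s (g, False))"
      using compatible_coloringD(2)[OF c s, of "(g, True)" "s (g, False)"] s[of "(g, False)"]
      by (simp add: letter_inv_def eq_commute)
    then show ?thesis
      using permutation_with_two_values[of "c (s (g, True))" "range c" "c (g, False)" "c (g, True)" "c (s (g, False))"]
      by blast
  qed
  then obtain p where p: "\<And>g. p g permutes range c" "\<And>g. p g (c (s (g, True))) = c (g, True)"
      "\<And>g. p g (c (g, False)) = c (s (g, False))"
    by metis
  define \<theta> where "\<theta> a = (if snd a then p (fst a) else inv_into UNIV (p (fst a)))" for a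
  show thesis
  proof
    show "\<theta> a permutes range c" for a
      using p(1) by (auto simp: \<theta>_def permutes_inv)
    show "\<theta> (letter_inv a) (\<theta> a q) = q" for a q
      using permutes_inverses[OF p(1)] by (simp add: \<theta>_def letter_inv_def)
    show "\<theta> a (c b) = c a" if ab: "0 < P a b" for a b
    proof (cases a)
      case (Pair g e)
      show ?thesis
      proof (cases e)
        case True
        then show ?thesis using p(2) s_eq[OF ab] Pair by (simp add: \<theta>_def)
      next
        case False
        then have "c b = p g (c a)" using p(3) s_eq[OF ab] Pair by simp
        then show ?thesis using False Pair permutes_inverses[OF p(1)] by (simp add: \<theta>_def)
      qed
    qed
  qed
qed

lemma group_action_foldr:
  assumes cl: "\<And>a x. x \<in> S \<Longrightarrow> \<theta> a x \<in> S" and inv: "\<And>a x. x \<in> S \<Longrightarrow> \<theta> (letter_inv a) (\<theta> a x) = x"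
  shows "group_action (free_group :: 'g letter list monoid) S (\<lambda>w. \<lambda>x\<in>S. foldr \<theta> w x)"
proof -
  interpret group "free_group :: 'g letter list monoid" by (rule group_free_group)
  have closed: "foldr \<theta> w x \<in> S" if "x \<in> S" for w x
    using foldr_closed[of S \<theta>, OF cl that] .
  have inverse: "foldr \<theta> (map letter_inv (rev w)) (foldr \<theta> w x) = x" if "x \<in> S" for w x
    using foldr_inverse[of S \<theta>, OF cl inv that] .
  have inverse': "foldr \<theta> w (foldr \<theta> (map letter_inv (rev w)) x) = x" if "x \<in> S" for w x
    using inverse[OF that, of "map letter_inv (rev w)"] by (simp add: rev_map comp_def)
  have bij: "(\<lambda>x\<in>S. foldr \<theta> w x) \<in> Bij S" for w
  proof -
    have "bij_betw (foldr \<theta> w) S S"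
      by (rule bij_betwI[where g = "foldr \<theta> (map letter_inv (rev w))"]) (auto simp: closed inverse inverse')
    then show ?thesis by (simp add: Bij_def)
  qed
  show ?thesis
    unfolding group_action_def
  proof (intro group_hom.intro group_hom_axioms.intro homI group_BijGroup is_group)
    fix u v :: "'g letter list"
    show "(\<lambda>x\<in>S. foldr \<theta> (u \<otimes>\<^bsub>free_group\<^esub> v) x)
        = (\<lambda>x\<in>S. foldr \<theta> u x) \<otimes>\<^bsub>BijGroup S\<^esub> (\<lambda>x\<in>S. foldr \<theta> v x)"
      using bij foldr_reduce[of S \<theta> _ "u @ v", OF cl inv]
      by (auto simp: BijGroup_def compose_def free_group_def closed fun_eq_iff)
  qed (use bij in \<open>auto simp: BijGroup_def\<close>)
qed

lemma standard_borel_uniform_count: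
  assumes "finite S" shows "standard_borel (uniform_count_measure S)"
  unfolding standard_borel_def
proof (intro exI conjI)
  show "topspace (discrete_topology S) = space (uniform_count_measure S)"
    by (simp add: space_uniform_count_measure)
  show "completely_metrizable_space (discrete_topology S)"
    by (rule completely_metrizable_space_discrete_topology)
  show "second_countable (discrete_topology S)"
    using assms by (simp add: second_countable_discrete_topology countable_finite)
  have "sigma_sets S (Pow S) = Pow S"
    by (rule sigma_algebra.sigma_sets_eq[OF sigma_algebra_Pow])
  then show "sets (uniform_count_measure S) = sigma_sets (space (uniform_count_measure S)) {U. openin (discrete_topology S) U}"
    by (simp add: space_uniform_count_measure sets_uniform_count_measure Pow_def)
qed

lemma pmp_action_uniform_count:
  assumes S: "finite S" "S \<noteq> {}" and act: "group_action G S \<psi>"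
  shows "pmp_action G (uniform_count_measure S) \<psi>"
  unfolding pmp_action_def
proof (intro conjI ballI)
  let ?N = "uniform_count_measure S"
  show "prob_space ?N" using S by (rule prob_space_uniform_count_measure)
  show "group_action G (space ?N) \<psi>" using act by (simp add: space_uniform_count_measure)
  fix g assume "g \<in> carrier G"
  then have bij: "bij_betw (\<psi> g) S S"
    using group_action.bij_prop0[OF act] by (simp add: Bij_def)
  then have \<psi>: "\<psi> g ` S = S" "inj_on (\<psi> g) S" by (auto simp: bij_betw_def)
  show m: "\<psi> g \<in> measurable ?N ?N"
    using \<psi> by (auto simp: measurable_def space_uniform_count_measure sets_uniform_count_measure)
  show "distr ?N ?N (\<psi> g) = ?N"
  proof (rule measure_eqI)
    fix A assume "A \<in> sets (distr ?N ?N (\<psi> g))"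
    then have A: "A \<subseteq> S" by (simp add: sets_uniform_count_measure)
    have "\<psi> g ` (\<psi> g -` A \<inter> S) = A \<inter> \<psi> g ` S" by blast
    then have "\<psi> g ` (\<psi> g -` A \<inter> S) = A" using \<psi>(1) A by (simp add: Int_absorb2)
    moreover have "inj_on (\<psi> g) (\<psi> g -` A \<inter> S)" using \<psi>(2) by (rule inj_on_subset) auto
    ultimately have "card (\<psi> g -` A \<inter> S) = card A" by (metis card_image)
    then show "emeasure (distr ?N ?N (\<psi> g)) A = emeasure ?N A"
      using A S m by (simp add: emeasure_distr sets_uniform_count_measure space_uniform_count_measure
          emeasure_uniform_count_measure)
  qed simp
qed

text \<open>An invariant set of a transitive action is empty or everything, whatever the measure.\<close>

lemma ergodic_action_transitive:
  assumes trans: "\<And>x y. x \<in> space N \<Longrightarrow> y \<in> space N \<Longrightarrow> \<exists>g\<in>carrier G. \<psi> g x = y"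
  shows "ergodic_action G N \<psi>"
  unfolding ergodic_action_def
proof
  fix A assume A: "A \<in> invariant_sets G N \<psi>"
  then have sub: "A \<subseteq> space N" by (auto simp: invariant_sets_def dest: sets.sets_into_space)
  show "A \<in> null_sets N \<or> space N - A \<in> null_sets N"
  proof (cases "A = {}")
    case False
    then obtain x where x: "x \<in> A" by blast
    have "y \<in> A" if y': "y \<in> space N" for y
    proof -
      obtain g where g: "g \<in> carrier G" and y: "\<psi> g x = y"
        using trans[OF subsetD[OF sub x] y'] by blast
      have "\<psi> g x \<in> \<psi> g ` A" using x by (rule imageI)
      then show ?thesis using A g y by (auto simp: invariant_sets_def)
    qed
    then have diff: "space N - A = {}" by blast
    show ?thesis unfolding diff by simp
  qed simp
qed

lemma sets_finitely_determined:
  fixes R :: "(nat \<Rightarrow> 's::finite) \<Rightarrow> bool"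
  assumes R: "\<And>y y'. (\<And>i. i < n \<Longrightarrow> y i = y' i) \<Longrightarrow> R y \<Longrightarrow> R y'"
  shows "{y. R y} \<in> sets (\<Pi>\<^sub>M i\<in>UNIV. count_space UNIV)"
proof -
  define W where "W = {w. length w = n \<and> (\<exists>y\<in>cylinder w. R y)}"
  have "finite W"
    by (rule finite_subset[OF _ finite_lists_length_eq[of UNIV n]]) (auto simp: W_def)
  moreover have "{y. R y} = (\<Union>w\<in>W. cylinder w)"
  proof (intro equalityI subsetI)
    fix y assume "y \<in> {y. R y}"
    then have "map y [0..<n] \<in> W" "y \<in> cylinder (map y [0..<n])"
      by (auto simp: W_def cylinder_def intro!: bexI[of _ y])
    then show "y \<in> (\<Union>w\<in>W. cylinder w)" by blast
  next
    fix y assume "y \<in> (\<Union>w\<in>W. cylinder w)"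
    then obtain w z where "length w = n" "y \<in> cylinder w" "z \<in> cylinder w" "R z" by (auto simp: W_def)
    then show "y \<in> {y. R y}" using R[of z y] by (simp add: cylinder_def)
  qed
  ultimately show ?thesis
    by (auto intro!: sets.finite_UN measurable_cylinder)
qed

text \<open>The second component of the \<open>m\<close>-th iterate of the map
  \<open>(y, q) \<mapsto> (shift y, \<theta> (letter_inv (y 0)) q)\<close>. On pairs this map is the diagonal action of the inverse of the
  first letter of \<open>y\<close>.\<close>

primrec track :: "('g letter \<Rightarrow> 'q \<Rightarrow> 'q) \<Rightarrow> (nat \<Rightarrow> 'g letter) \<Rightarrow> 'q \<Rightarrow> nat \<Rightarrow> 'q" where
  "track \<theta> y q 0 = q"
| "track \<theta> y q (Suc m) = \<theta> (letter_inv (y m)) (track \<theta> y q m)"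

lemma track_shift: "track \<theta> y q (Suc m) = track \<theta> (\<lambda>n. y (Suc n)) (\<theta> (letter_inv (y 0)) q) m"
  by (induction m) simp_all

lemma track_cong: "(\<And>i. i < m \<Longrightarrow> y i = y' i) \<Longrightarrow> track \<theta> y q m = track \<theta> y' q m"
  by (induction m) simp_all

text \<open>The set of pairs with \<open>q = c (y 0)\<close> is invariant only along paths all of whose transitions have
  positive probability. Asking for the equality eventually along the shift makes it invariant everywhere and
  changes it only on a null set.\<close>

definition eventually_tracks :: "('g letter \<Rightarrow> 'q \<Rightarrow> 'q) \<Rightarrow> ('g letter \<Rightarrow> 'q) \<Rightarrow> (nat \<Rightarrow> 'g letter) \<Rightarrow> 'q \<Rightarrow> bool" where
  "eventually_tracks \<theta> c y q \<longleftrightarrow> (\<forall>\<^sub>F m in sequentially. track \<theta> y q m = c (y m))"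

lemma eventually_tracks_shift:
  "eventually_tracks \<theta> c y q \<longleftrightarrow> eventually_tracks \<theta> c (\<lambda>n. y (Suc n)) (\<theta> (letter_inv (y 0)) q)"
  using eventually_sequentially_Suc[of "\<lambda>m. track \<theta> y q m = c (y m)"]
  by (simp add: eventually_tracks_def track_shift del: track.simps(2))

text \<open>Either pushing \<open>a\<close> is the shift, or the shift undoes it.\<close>

lemma eventually_tracks_push:
  assumes inv: "\<And>a q. \<theta> (letter_inv a) (\<theta> a q) = q"
  shows "eventually_tracks \<theta> c (push_inf a y) (\<theta> a q) \<longleftrightarrow> eventually_tracks \<theta> c y q"
proof (cases "y 0 = letter_inv a")
  case True
  then show ?thesis
    using eventually_tracks_shift[of \<theta> c y q] by (simp add: push_inf_def)
next
  case False
  then show ?thesis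
    using eventually_tracks_shift[of \<theta> c "push_inf a y" "\<theta> a q"] by (simp add: push_inf_def inv)
qed

lemma eventually_tracks_foldr:
  assumes "\<And>a q. \<theta> (letter_inv a) (\<theta> a q) = q"
  shows "eventually_tracks \<theta> c (foldr push_inf w y) (foldr \<theta> w q) \<longleftrightarrow> eventually_tracks \<theta> c y q"
  by (induction w) (simp_all add: eventually_tracks_push assms)

lemma sets_eventually_tracks:
  fixes c :: "'g::finite letter \<Rightarrow> 'q"
  shows "{y. eventually_tracks \<theta> c y q} \<in> sets (\<Pi>\<^sub>M i\<in>UNIV. count_space UNIV)"
proof -
  have "{y. track \<theta> y q m = c (y m)} \<in> sets (\<Pi>\<^sub>M i\<in>UNIV. count_space UNIV)" for m
    by (rule sets_finitely_determined[of "Suc m"]) (metis less_Suc_eq track_cong)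
  then have "(\<Union>n. \<Inter>m\<in>{n..}. {y. track \<theta> y q m = c (y m)}) \<in> sets (\<Pi>\<^sub>M i\<in>UNIV. count_space UNIV)"
    by (intro sets.countable_UN sets.countable_INT'') auto
  also have "(\<Union>n. \<Inter>m\<in>{n..}. {y. track \<theta> y q m = c (y m)}) = {y. eventually_tracks \<theta> c y q}"
    by (auto simp: eventually_tracks_def eventually_sequentially)
  finally show ?thesis .
qed

lemma eventually_tracks_iff:
  assumes inv: "\<And>a q. \<theta> (letter_inv a) (\<theta> a q) = q"
    and \<theta>: "\<And>a b. 0 < P a b \<Longrightarrow> \<theta> a (c b) = c a"
    and y: "\<And>i. 0 < P (y i) (y (Suc i))"
  shows "eventually_tracks \<theta> c y q \<longleftrightarrow> q = c (y 0)"
proof -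
  have "track \<theta> y q m = c (y m) \<longleftrightarrow> q = c (y 0)" for m
  proof (induction m)
    case (Suc m)
    have "\<theta> (letter_inv (y m)) (c (y m)) = c (y (Suc m))"
      using inv \<theta>[OF y[of m]] by metis
    moreover have "\<theta> (y m) (\<theta> (letter_inv (y m)) q') = q'" for q'
      using inv[of "letter_inv (y m)"] by simp
    ultimately have "track \<theta> y q (Suc m) = c (y (Suc m)) \<longleftrightarrow> track \<theta> y q m = c (y m)"
      by (metis track.simps(2))
    then show ?case using Suc by simp
  qed simp
  then show ?thesis by (simp add: eventually_tracks_def)
qed

lemma AE_path_positive:
  fixes \<pi> :: "'s::finite \<Rightarrow> real"
  assumes mc: "markov_chain \<pi> P"
  shows "AE y in path_measure \<pi> P. \<forall>i. 0 < P (y i) (y (Suc i))"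
proof -
  interpret prob_space "path_measure \<pi> P" using path_measure[OF mc] by blast
  have sets: "sets (path_measure \<pi> P) = sets (\<Pi>\<^sub>M i\<in>UNIV. count_space UNIV)"
    using path_measure[OF mc] by blast
  have "AE y in path_measure \<pi> P. markov_measure \<pi> P w = 0 \<longrightarrow> y \<notin> cylinder w" for w
  proof (cases "markov_measure \<pi> P w = 0")
    case True
    then have "cylinder w \<in> null_sets (path_measure \<pi> P)"
      using path_measure[OF mc] measurable_cylinder[of w] by (auto simp: null_sets_def emeasure_eq_measure)
    then show ?thesis using AE_not_in by auto
  qed simp
  then have "AE y in path_measure \<pi> P. \<forall>w. markov_measure \<pi> P w = 0 \<longrightarrow> y \<notin> cylinder w"
    by (simp add: AE_all_countable)
  then show ?thesis
  proof eventually_elim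
    case (elim y)
    show ?case
    proof (rule allI, rule ccontr)
      fix i assume "\<not> 0 < P (y i) (y (Suc i))"
      then have "P (y i) (y (Suc i)) = 0" using mc by (metis markov_chain_def less_eq_real_def)
      then have "markov_measure \<pi> P (map y [0..<Suc (Suc i)]) = 0"
        using markov_measure_snoc[of \<pi> P "map y [0..<Suc i]" "y (Suc i)"] by simp
      moreover have "y \<in> cylinder (map y [0..<Suc (Suc i)])"
        unfolding cylinder_def by (simp del: upt_Suc)
      ultimately show False using elim by blast
    qed
  qed
qed

text \<open>Almost every path has only transitions of positive probability. Such a path is reduced, so the
  restriction to the boundary loses no mass.\<close>

lemma emeasure_boundary_start:
  fixes \<pi> :: "'g::finite letter \<Rightarrow> real"
  assumes mc: "markov_chain \<pi> P" and supp: "\<And>a. P a (letter_inv a) = 0"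
  defines "E \<equiv> \<lambda>b. {y. y 0 = b \<and> (\<forall>i. 0 < P (y i) (y (Suc i)))}"
  shows "E b \<in> sets (boundary_measure \<pi> P)" "emeasure (boundary_measure \<pi> P) (E b) = \<pi> b"
    "E b \<subseteq> boundary"
proof -
  interpret prob_space "path_measure \<pi> P" using path_measure[OF mc] by blast
  have sets [simp]: "sets (path_measure \<pi> P) = sets (\<Pi>\<^sub>M i\<in>UNIV. count_space UNIV)"
    using path_measure[OF mc] by blast
  have space: "space (path_measure \<pi> P) = UNIV"
    using sets_eq_imp_space_eq[OF sets] by (simp add: space_PiM)
  show sub: "E b \<subseteq> boundary"
  proof
    fix y assume "y \<in> E b"
    then have y: "0 < P (y i) (y (Suc i))" for i by (simp add: E_def)
    have "y (Suc i) \<noteq> letter_inv (y i)" for i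
      using y[of i] supp[of "y i"] by auto
    then show "y \<in> boundary" by (simp add: boundary_def)
  qed
  have "{y. R (y i) (y (Suc i))} \<in> sets (path_measure \<pi> P)" for R i
    unfolding sets by (rule sets_finitely_determined[of "Suc (Suc i)"]) simp
  then have all: "(\<Inter>i. {y. R (y i) (y (Suc i))}) \<in> sets (path_measure \<pi> P)" for R
    using sets.top[of "path_measure \<pi> P"] by (intro sets.countable_INT'') (auto simp: space)
  have "(boundary :: (nat \<Rightarrow> 'g letter) set) = (\<Inter>i. {y. y (Suc i) \<noteq> letter_inv (y i)})" by (auto simp: boundary_def)
  then have bd: "(boundary :: (nat \<Rightarrow> 'g letter) set) \<in> sets (path_measure \<pi> P)" using all[of "\<lambda>a b. b \<noteq> letter_inv a"] by (simp only:)
  have "E b = cylinder [b] \<inter> (\<Inter>i. {y. 0 < P (y i) (y (Suc i))})" by (auto simp: E_def cylinder_def)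
  then have E: "E b \<in> sets (path_measure \<pi> P)" using all[of "\<lambda>a b. 0 < P a b"] measurable_cylinder[of "[b]"] by auto
  then show "E b \<in> sets (boundary_measure \<pi> P)"
    unfolding boundary_measure_def sets_restrict_space using sub by auto
  have "emeasure (boundary_measure \<pi> P) (E b) = emeasure (path_measure \<pi> P) (E b)"
    unfolding boundary_measure_def using bd sub by (intro emeasure_restrict_space) (auto simp: space)
  also have "\<dots> = emeasure (path_measure \<pi> P) (cylinder [b])"
  proof (rule emeasure_eq_AE)
    show "AE y in path_measure \<pi> P. y \<in> E b \<longleftrightarrow> y \<in> cylinder [b]"
      using AE_path_positive[OF mc] by eventually_elim (auto simp: E_def cylinder_def)
  qed (use E measurable_cylinder[of "[b]"] in auto)
  also have "\<dots> = \<pi> b"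
    using path_measure[OF mc] by (simp add: emeasure_eq_measure markov_measure_def)
  finally show "emeasure (boundary_measure \<pi> P) (E b) = \<pi> b" .
qed

text \<open>Otherwise let the free group act on the orbit \<open>S\<close> of the color of \<open>a\<close>. The set of pairs \<open>(y, q)\<close> such that \<open>q\<close>
  tracks \<open>y\<close> is invariant in the product with this transitive action. It contains almost all
  pairs \<open>(y, c a)\<close> with \<open>y 0 = a\<close>, and almost none with \<open>y 0 = b\<close>, so it is neither null nor conull.
  Colors are real numbers because weak mixing is tested on actions on sets of reals.\<close>

lemma weakly_mixing_coloring_constant:
  fixes \<pi> :: "'g::finite letter \<Rightarrow> real" and c :: "'g letter \<Rightarrow> real"
  assumes mc: "markov_chain \<pi> P" and pos: "\<forall>a. 0 < \<pi> a" and supp: "\<And>a. P a (letter_inv a) = 0"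
    and wm: "weakly_mixing free_group (boundary_measure \<pi> P) boundary_action"
    and c: "compatible_coloring P c"
  shows "c a = c b"
proof (rule ccontr)
  assume ne: "c a \<noteq> c b"
  obtain \<theta> where perm: "\<And>a. \<theta> a permutes range c" and inv: "\<And>a q. \<theta> (letter_inv a) (\<theta> a q) = q"
    and \<theta>: "\<And>a b. 0 < P a b \<Longrightarrow> \<theta> a (c b) = c a"
    using coloring_permutations[OF c markov_chain_successor[OF mc]] by blast
  define S where "S = range (\<lambda>w. foldr \<theta> w (c a))"
  have cl: "\<theta> a q \<in> S" if "q \<in> S" for a q
    using that unfolding S_def by (auto intro: range_eqI[of _ _ "a # _"])
  have "foldr \<theta> w (c a) \<in> range c" for w
    by (rule foldr_closed) (auto simp: permutes_in_image[OF perm])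
  then have S: "finite S" "c a \<in> S"
    unfolding S_def by (auto intro: finite_subset[of _ "range c"] range_eqI[of _ _ "[]"])
  have foldr_inv: "foldr \<theta> (map letter_inv (rev w)) (foldr \<theta> w q) = q" for w q
    by (rule foldr_inverse[of UNIV]) (auto simp: inv)
  have foldr_inv': "foldr \<theta> w (foldr \<theta> (map letter_inv (rev w)) q) = q" for w q
    using foldr_inv[of "map letter_inv (rev w)" q] by (simp add: rev_map comp_def)
  have bd_inv': "foldr push_inf w (foldr push_inf (map letter_inv (rev w)) y) = y" if "y \<in> boundary"
    for w and y :: "nat \<Rightarrow> 'g letter"
    using foldr_inverse[of boundary push_inf, OF push_inf_boundary push_inf_push_inf that, of "map letter_inv (rev w)"]
    by (simp add: rev_map comp_def)
  define N where "N = uniform_count_measure S"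
  define \<psi> where "\<psi> = (\<lambda>w. \<lambda>q\<in>S. foldr \<theta> w q)"
  have act: "group_action free_group S \<psi>"
    unfolding \<psi>_def by (rule group_action_foldr) (auto simp: cl inv)
  have N: "space N = S" "sets N = Pow S"
    by (simp_all add: N_def space_uniform_count_measure sets_uniform_count_measure)
  have "standard_borel N" "pmp_action free_group N \<psi>"
    unfolding N_def using S act by (auto intro: standard_borel_uniform_count pmp_action_uniform_count)
  moreover have "ergodic_action free_group N \<psi>"
  proof (rule ergodic_action_transitive)
    fix q r assume "q \<in> space N" "r \<in> space N"
    then obtain u v where q: "q = foldr \<theta> u (c a)" and r: "r = foldr \<theta> v (c a)" and "q \<in> S"
      by (auto simp: N S_def)
    let ?w = "v @ map letter_inv (rev u)"
    have "\<psi> (reduce ?w) q = foldr \<theta> ?w q"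
      using foldr_reduce[of S \<theta> q ?w] \<open>q \<in> S\<close> by (simp add: \<psi>_def cl inv)
    also have "\<dots> = r" by (simp add: q r foldr_inv)
    finally show "\<exists>g\<in>carrier free_group. \<psi> g q = r"
      by (intro bexI[of _ "reduce ?w"]) (simp_all add: reduced_reduce)
  qed
  ultimately have erg: "ergodic_action free_group (boundary_measure \<pi> P \<Otimes>\<^sub>M N) (\<lambda>g. map_prod (boundary_action g) (\<psi> g))"
    using wm unfolding weakly_mixing_def by blast
  let ?B = "boundary_measure \<pi> P"
  have space: "space ?B = boundary"
    using sets_eq_imp_space_eq[OF path_measure[OF mc, THEN conjunct1]]
    by (simp add: boundary_measure_def space_restrict_space space_PiM)
  have prob: "prob_space N" using S unfolding N_def by (intro prob_space_uniform_count_measure) auto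
  then interpret N: prob_space N .
  define A where "A = {(y, q). y \<in> boundary \<and> q \<in> S \<and> eventually_tracks \<theta> c y q}"
  have "A \<in> sets (?B \<Otimes>\<^sub>M N)"
  proof -
    have "{y \<in> boundary. eventually_tracks \<theta> c y q} \<in> sets ?B" for q
    proof -
      have "{y \<in> boundary. eventually_tracks \<theta> c y q} = boundary \<inter> {y. eventually_tracks \<theta> c y q}" by blast
      then show ?thesis
        using sets_eventually_tracks[of \<theta> c q] path_measure[OF mc]
        by (auto simp: boundary_measure_def sets_restrict_space)
    qed
    then have "(\<Union>q\<in>S. {y \<in> boundary. eventually_tracks \<theta> c y q} \<times> {q}) \<in> sets (?B \<Otimes>\<^sub>M N)"
      using S by (intro sets.finite_UN pair_measureI) (auto simp: N)
    also have "(\<Union>q\<in>S. {y \<in> boundary. eventually_tracks \<theta> c y q} \<times> {q}) = A"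
      by (auto simp: A_def)
    finally show ?thesis .
  qed
  moreover have "map_prod (boundary_action g) (\<psi> g) ` A = A" for g
  proof -
    have step: "(foldr push_inf w y, foldr \<theta> w q) \<in> A" if "(y, q) \<in> A" for w y q
      using that foldr_closed[of boundary push_inf y w, OF push_inf_boundary] foldr_closed[of S \<theta> q w, OF cl]
      by (auto simp: A_def eventually_tracks_foldr[where \<theta> = \<theta>, OF inv])
    have eq: "map_prod (boundary_action g) (\<psi> g) (y, q) = (foldr push_inf g y, foldr \<theta> g q)" if "(y, q) \<in> A" for y q
      using that by (simp add: A_def boundary_action_def \<psi>_def)
    show ?thesis
    proof (intro equalityI subsetI)
      fix z assume "z \<in> map_prod (boundary_action g) (\<psi> g) ` A"
      then obtain y q where "(y, q) \<in> A" "z = map_prod (boundary_action g) (\<psi> g) (y, q)" by auto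
      then show "z \<in> A" by (simp only: eq step)
    next
      fix z assume z: "z \<in> A"
      obtain y q where yq: "z = (y, q)" by (cases z)
      let ?g = "map letter_inv (rev g)"
      have "(foldr push_inf ?g y, foldr \<theta> ?g q) \<in> A" using step z yq by blast
      moreover from eq[OF this] have "map_prod (boundary_action g) (\<psi> g) (foldr push_inf ?g y, foldr \<theta> ?g q) = z"
        using z yq by (simp add: bd_inv' foldr_inv' A_def)
      ultimately show "z \<in> map_prod (boundary_action g) (\<psi> g) ` A" by (metis imageI)
    qed
  qed
  ultimately have "A \<in> invariant_sets free_group (?B \<Otimes>\<^sub>M N) (\<lambda>g. map_prod (boundary_action g) (\<psi> g))"
    by (simp add: invariant_sets_def)
  with erg have null: "A \<in> null_sets (?B \<Otimes>\<^sub>M N) \<or> space (?B \<Otimes>\<^sub>M N) - A \<in> null_sets (?B \<Otimes>\<^sub>M N)"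
    by (auto simp: ergodic_action_def)
  define E where "E b = {y. y 0 = b \<and> (\<forall>i. 0 < P (y i) (y (Suc i)))}" for b
  note E = emeasure_boundary_start[OF mc supp, folded E_def]
  have not_null: "\<not> E d \<times> {c a} \<subseteq> Z" if "Z \<in> null_sets (?B \<Otimes>\<^sub>M N)" for d Z
  proof
    assume "E d \<times> {c a} \<subseteq> Z"
    have "E d \<times> {c a} \<in> sets (?B \<Otimes>\<^sub>M N)" using E(1) S by (intro pair_measureI) (auto simp: N)
    then have "emeasure (?B \<Otimes>\<^sub>M N) (E d \<times> {c a}) = 0"
      using null_sets_subset[OF that _ \<open>E d \<times> {c a} \<subseteq> Z\<close>] by blast
    moreover have "emeasure (?B \<Otimes>\<^sub>M N) (E d \<times> {c a}) = emeasure ?B (E d) * emeasure N {c a}"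
      using E(1) S by (intro N.emeasure_pair_measure_Times) (auto simp: N)
    ultimately have "emeasure ?B (E d) = 0 \<or> emeasure N {c a} = 0" by simp
    moreover have "emeasure N {c a} = 1 / card S"
      using S by (simp add: N_def emeasure_uniform_count_measure)
    moreover have "0 < 1 / real (card S)" using S by (simp add: card_gt_0_iff) blast
    ultimately show False
      using E(2)[of d] pos[rule_format, of d] by (simp only: ennreal_eq_0_iff not_le[symmetric]) simp
  qed
  have in_A: "(y, c a) \<in> A \<longleftrightarrow> c a = c d" if "y \<in> E d" for y d
  proof -
    have "eventually_tracks \<theta> c y (c a) \<longleftrightarrow> c a = c (y 0)"
      using that by (intro eventually_tracks_iff[of \<theta> P] inv \<theta>) (auto simp: E_def)
    then show ?thesis using that E(3)[of d] S by (auto simp: A_def E_def)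
  qed
  have sub: "E a \<times> {c a} \<subseteq> A" "E b \<times> {c a} \<subseteq> space (?B \<Otimes>\<^sub>M N) - A"
    using in_A[of _ a] in_A[of _ b] ne E(3)[of b] S by (auto simp: space_pair_measure space N)
  from null show False
    using not_null[of A a] not_null[of "space (?B \<Otimes>\<^sub>M N) - A" b] sub by argo
qed

section \<open>The invariant algebra\<close>

lemma invariant_sets_iff:
  assumes act: "group_action G (space M) \<phi>"
  shows "A \<in> invariant_sets G M \<phi> \<longleftrightarrow>
    A \<in> sets M \<and> (\<forall>g\<in>carrier G. \<forall>x\<in>space M. \<phi> g x \<in> A \<longleftrightarrow> x \<in> A)"
proof -
  interpret group_action G "space M" \<phi> by fact
  have "\<phi> g ` A = A \<longleftrightarrow> (\<forall>x\<in>space M. \<phi> g x \<in> A \<longleftrightarrow> x \<in> A)" if g: "g \<in> carrier G" and "A \<in> sets M" for g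
  proof -
    have sub: "A \<subseteq> space M" using \<open>A \<in> sets M\<close> by (rule sets.sets_into_space)
    show ?thesis
    proof
      assume eq: "\<phi> g ` A = A"
      show "\<forall>x\<in>space M. \<phi> g x \<in> A \<longleftrightarrow> x \<in> A"
      proof (intro ballI iffI)
        fix x assume x: "x \<in> space M" and "\<phi> g x \<in> A"
        then obtain y where "y \<in> A" "\<phi> g x = \<phi> g y" using eq by (metis imageE)
        then show "x \<in> A" using inj_onD[OF inj_prop[OF g], of x y] x sub by auto
      qed (use eq in blast)
    next
      assume *: "\<forall>x\<in>space M. \<phi> g x \<in> A \<longleftrightarrow> x \<in> A"
      show "\<phi> g ` A = A"
      proof (intro equalityI subsetI)
        fix y assume y: "y \<in> A"
        then obtain x where "x \<in> space M" "\<phi> g x = y" using sub surj_prop[OF g] by (metis imageE subsetD)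
        then show "y \<in> \<phi> g ` A" using * y by blast
      qed (use * sub in blast)
    qed
  qed
  then show ?thesis by (auto simp: invariant_sets_def)
qed

lemma sets_invariant_algebra:
  assumes act: "group_action G (space M) \<phi>"
  shows "sets (invariant_algebra G M \<phi>) = invariant_sets G M \<phi>"
proof -
  interpret group_action G "space M" \<phi> by fact
  have "sigma_algebra (space M) (invariant_sets G M \<phi>)"
    unfolding sigma_algebra_iff2
  proof (intro conjI ballI allI impI)
    show "invariant_sets G M \<phi> \<subseteq> Pow (space M)"
      by (auto simp: invariant_sets_def dest: sets.sets_into_space)
    show "{} \<in> invariant_sets G M \<phi>" by (simp add: invariant_sets_def)
    show "space M - A \<in> invariant_sets G M \<phi>" if "A \<in> invariant_sets G M \<phi>" for A
      using that element_image unfolding invariant_sets_iff[OF act] by auto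
    show "(\<Union>i::nat. A i) \<in> invariant_sets G M \<phi>" if "range A \<subseteq> invariant_sets G M \<phi>" for A
    proof -
      have "A i \<in> invariant_sets G M \<phi>" for i using that by blast
      then show ?thesis unfolding invariant_sets_iff[OF act] by auto
    qed
  qed
  then show ?thesis
    by (simp add: invariant_algebra_def sigma_algebra.sets_measure_of_eq)
qed

lemma invariant_function:
  fixes g :: "'x \<Rightarrow> real"
  assumes act: "group_action G (space M) \<phi>" and g: "g \<in> borel_measurable (invariant_algebra G M \<phi>)"
    and w: "w \<in> carrier G" and x: "x \<in> space M"
  shows "g (\<phi> w x) = g x"
proof -
  have space: "space (invariant_algebra G M \<phi>) = space M"
    by (simp add: invariant_algebra_def space_measure_of_conv)
  have "g -` {g x} \<inter> space M \<in> invariant_sets G M \<phi>"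
    using measurable_sets[OF g, of "{g x}"] by (simp add: space sets_invariant_algebra[OF act])
  then have "\<phi> w x \<in> g -` {g x} \<inter> space M \<longleftrightarrow> x \<in> g -` {g x} \<inter> space M"
    using w x unfolding invariant_sets_iff[OF act] by blast
  then show ?thesis using x by simp
qed

lemma subalgebra_invariant:
  assumes act: "group_action G (space M) \<phi>"
  shows "subalgebra M (invariant_algebra G M \<phi>)"
  unfolding subalgebra_def sets_invariant_algebra[OF act]
  by (auto simp: invariant_algebra_def space_measure_of_conv invariant_sets_def)

section \<open>Tree sums are bounded\<close>

text \<open>Letters are pairs; splitting quantifiers over letters would destroy the shape of the facts below.\<close>

declare split_paired_All [simp del]

lemma random_maps_reversal:
  fixes \<pi> :: "'g::finite letter \<Rightarrow> real"
  assumes pmp: "pmp_action free_group M \<alpha>" and mc: "markov_chain \<pi> P" and st: "stationary \<pi> P"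
    and pos: "\<forall>a. 0 < \<pi> a"
  shows "random_maps M (\<lambda>a. \<alpha> [a]) \<pi> (reversal \<pi> P)"
proof -
  interpret prob_space M using pmp by (simp add: pmp_action_def)
  have nz: "\<pi> a \<noteq> 0" for a using pos[rule_format, of a] by simp
  have letter: "[a] \<in> carrier free_group" for a :: "'g letter" by (simp add: reduced_Cons)
  show ?thesis
  proof
    show "\<alpha> [a] \<in> measurable M M" "distr M M (\<alpha> [a]) = M" for a
      using pmp letter[of a] unfolding pmp_action_def by blast+
    show "0 \<le> reversal \<pi> P b a" for b a by (rule reversal_nonneg[OF mc])
    show "0 < \<pi> b" for b using pos by blast
    show "(\<Sum>a\<in>UNIV. reversal \<pi> P b a) = 1" for b
      using st[unfolded stationary_def, rule_format, of b] nz[of b]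
      by (simp add: reversal_def sum_divide_distrib[symmetric])
    have "\<pi> b * reversal \<pi> P b a = \<pi> a * P a b" for a b
      using nz[of b] by (simp add: reversal_def)
    moreover have "(\<Sum>b\<in>UNIV. P a b) = 1" for a using mc unfolding markov_chain_def by blast
    ultimately show "(\<Sum>b\<in>UNIV. \<pi> b * reversal \<pi> P b a) = \<pi> a" for a
      by (simp add: sum_distrib_left[symmetric])
  qed
qed

lemma action_letter_inv:
  assumes "group_action free_group S \<alpha>" "x \<in> S"
  shows "\<alpha> [a] (\<alpha> [letter_inv a] x) = x"
proof -
  interpret group_action free_group S \<alpha> by fact
  have "[a] \<otimes>\<^bsub>free_group\<^esub> [letter_inv a] = []"
    by (simp add: free_group_def reduce_def)
  then show ?thesis
    using composition_rule[OF assms(2), of "[a]" "[letter_inv a]"] action_Nil[OF assms] by (simp add: reduced_Cons)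
qed

text \<open>Color a letter \<open>b\<close> by the class modulo null sets of the set \<open>D b\<close> of unbounded gain. This coloring is
  compatible, so weak mixing makes all the sets \<open>D b\<close> agree almost everywhere, with
  an invariant set \<open>D'\<close>. The maximal inequality on \<open>D'\<close> leaves only measure 0 for it.\<close>

lemma AE_bounded_gain:
  fixes \<pi> :: "'g::finite letter \<Rightarrow> real" and f g :: "'x \<Rightarrow> real"
  assumes pmp: "pmp_action free_group M \<alpha>" and mc: "markov_chain \<pi> P" and st: "stationary \<pi> P"
    and pos: "\<forall>a. 0 < \<pi> a" and supp: "\<And>a. P a (letter_inv a) = 0"
    and wm: "weakly_mixing free_group (boundary_measure \<pi> P) boundary_action"
    and f: "integrable M f" and g: "integrable M g"
    and fg: "\<And>A. A \<in> invariant_sets free_group M \<alpha> \<Longrightarrow> (\<integral>x\<in>A. f x \<partial>M) = (\<integral>x\<in>A. g x \<partial>M)"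
    and \<epsilon>: "0 < \<epsilon>"
  shows "AE x in M. \<forall>b. x \<notin> unbounded_gain (reversal \<pi> P) (\<lambda>a. \<alpha> [a]) (\<lambda>x. f x - g x - \<epsilon>) b"
proof -
  interpret random_maps M "\<lambda>a. \<alpha> [a]" \<pi> "reversal \<pi> P"
    by (rule random_maps_reversal[OF pmp mc st pos])
  have act: "group_action free_group (space M) \<alpha>" using pmp by (simp add: pmp_action_def)
  interpret A: group_action free_group "space M" \<alpha> by (rule act)
  interpret F: group "free_group :: 'g letter list monoid" by (rule group_free_group)
  define h where "h = (\<lambda>x. f x - g x - \<epsilon>)"
  have h: "integrable M h" using f g by (simp add: h_def)
  have h_meas [measurable]: "h \<in> borel_measurable M" using h by simp
  define D where "D = unbounded_gain (reversal \<pi> P) (\<lambda>a. \<alpha> [a]) h"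
  have rev: "0 < reversal \<pi> P b a \<longleftrightarrow> 0 < P a b" for a b
    using pos[rule_format, of a] pos[rule_format, of b] by (simp add: reversal_def zero_less_divide_iff zero_less_mult_iff)
  have step: "AE x in M. x \<in> D b \<longleftrightarrow> \<alpha> [a] x \<in> D a" if "0 < P a b" for a b
    using unbounded_gain_invariant[OF h_meas] by eventually_elim (use that in \<open>auto simp: rev D_def\<close>)
  define R where "R a b \<longleftrightarrow> (AE x in M. x \<in> D a \<longleftrightarrow> x \<in> D b)" for a b
  have R_refl: "R a a" for a by (simp add: R_def)
  have R_sym: "R b a" if "R a b" for a b
    using that unfolding R_def by eventually_elim simp
  have R_trans: "R a d" if "R a b" "R b d" for a b d
    using that unfolding R_def by eventually_elim simp
  \<comment> \<open>The classes of \<open>R\<close> have to be encoded by real numbers.\<close>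
  define c where "c a = real (to_nat {b. R a b})" for a
  have c: "c a = c b \<longleftrightarrow> R a b" for a b
  proof -
    have "c a = c b \<longleftrightarrow> {d. R a d} = {d. R b d}" by (simp add: c_def)
    also have "\<dots> \<longleftrightarrow> R a b" using R_refl R_sym R_trans by blast
    finally show ?thesis .
  qed
  \<comment> \<open>Translating by the inverse of \<open>a\<close> turns the equality of \<open>D b\<close> and \<open>D (letter_inv a)\<close> into that of
      \<open>D a\<close> and \<open>D b'\<close>.\<close>
  have half: "R b' a" if "0 < P a b" "0 < P (letter_inv a) b'" "R b (letter_inv a)" for a b b'
  proof -
    have "AE x in M. x \<in> D b' \<longleftrightarrow> \<alpha> [letter_inv a] x \<in> D (letter_inv a)" by (rule step[OF that(2)])
    moreover have "AE x in M. \<alpha> [letter_inv a] x \<in> D b \<longleftrightarrow> \<alpha> [letter_inv a] x \<in> D (letter_inv a)"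
      using that(3) unfolding R_def by (rule AE_T)
    moreover have "AE x in M. \<alpha> [letter_inv a] x \<in> D b \<longleftrightarrow> \<alpha> [a] (\<alpha> [letter_inv a] x) \<in> D a"
      using step[OF that(1)] by (rule AE_T)
    ultimately show ?thesis
      unfolding R_def using AE_space by eventually_elim (simp add: action_letter_inv[OF act])
  qed
  have "compatible_coloring P c"
    unfolding compatible_coloring_def c
  proof (intro conjI allI impI)
    show "R b b'" if "0 < P a b" "0 < P a b'" for a b b'
      using step[OF that(1)] step[OF that(2)] unfolding R_def by eventually_elim simp
    show "R b (letter_inv a) \<longleftrightarrow> R b' a" if "0 < P a b" "0 < P (letter_inv a) b'" for a b b'
      using half[of a b b'] half[of "letter_inv a" b' b] that by auto
  qed
  then have R: "R a b" for a b
    using weakly_mixing_coloring_constant[OF mc pos supp wm] c by blast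
  obtain b\<^sub>0 :: "'g letter" where True by blast
  have AE_w: "AE x in M. \<forall>b. \<alpha> w x \<in> D b \<longleftrightarrow> x \<in> D b\<^sub>0" if "reduced_word w" for w
    using that
  proof (induction w rule: rev_induct)
    case Nil
    have "AE x in M. \<forall>b. x \<in> D b \<longleftrightarrow> x \<in> D b\<^sub>0"
      using R unfolding R_def AE_all_countable by blast
    then show ?case
      using AE_space by eventually_elim (simp add: action_Nil[OF act])
  next
    case (snoc a u)
    then have "reduced_word u" by (simp add: reduced_word_def successively_append_iff)
    then have "AE x in M. \<forall>b. \<alpha> u (\<alpha> [a] x) \<in> D b \<longleftrightarrow> \<alpha> [a] x \<in> D b\<^sub>0"
      using snoc.IH by (intro AE_T)
    moreover obtain b where "0 < P a b" using markov_chain_successor[OF mc] by blast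
    then have "AE x in M. x \<in> D b \<longleftrightarrow> \<alpha> [a] x \<in> D a" by (rule step)
    moreover have "AE x in M. x \<in> D b \<longleftrightarrow> x \<in> D b\<^sub>0" using R unfolding R_def .
    moreover have "AE x in M. \<alpha> [a] x \<in> D a \<longleftrightarrow> \<alpha> [a] x \<in> D b\<^sub>0" using R unfolding R_def by (rule AE_T)
    ultimately show ?case
      using AE_space by eventually_elim (simp add: action_snoc[OF act _ snoc.prems])
  qed
  \<comment> \<open>A strictly invariant version of the common set, as the maximal inequality and the
      identity \<open>fg\<close> require.\<close>
  define D' where "D' = {x \<in> space M. \<forall>w\<in>carrier free_group. \<forall>b. \<alpha> w x \<in> D b}"
  have D'_sets: "D' \<in> sets M"
    unfolding D'_def
  proof (rule sets.sets_Collect_countable_All')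
    fix w :: "'g letter list" assume "w \<in> carrier free_group"
    then have [measurable]: "\<alpha> w \<in> measurable M M" using pmp by (simp add: pmp_action_def)
    have [measurable]: "Measurable.pred M (\<lambda>x. x \<in> D b)" for b
      unfolding D_def by measurable
    show "{x \<in> space M. \<forall>b. \<alpha> w x \<in> D b} \<in> sets M" by measurable
  qed simp
  have D'_step: "\<alpha> v x \<in> D'" if "x \<in> D'" "v \<in> carrier free_group" for v x
  proof -
    have x: "x \<in> space M" using that by (simp add: D'_def)
    have "\<alpha> w (\<alpha> v x) \<in> D b" if w: "w \<in> carrier free_group" for w b
    proof -
      have "w \<otimes>\<^bsub>free_group\<^esub> v \<in> carrier free_group" using w \<open>v \<in> carrier free_group\<close> by (rule F.m_closed)
      then have "\<alpha> (w \<otimes>\<^bsub>free_group\<^esub> v) x \<in> D b" using \<open>x \<in> D'\<close> unfolding D'_def by blast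
      then show ?thesis using A.composition_rule[OF x w \<open>v \<in> carrier free_group\<close>] by simp
    qed
    moreover have "\<alpha> v x \<in> space M" using A.element_image that x by blast
    ultimately show ?thesis unfolding D'_def by blast
  qed
  have D'_iff: "\<alpha> v x \<in> D' \<longleftrightarrow> x \<in> D'" if "v \<in> carrier free_group" "x \<in> space M" for v x
    using D'_step[of x v] D'_step[of "\<alpha> v x" "inv\<^bsub>free_group\<^esub> v"] A.orbit_sym_aux[OF that refl] F.inv_closed[OF that(1)] that(1)
    by metis
  have inv: "D' \<in> invariant_sets free_group M \<alpha>"
    unfolding invariant_sets_iff[OF act] using D'_sets D'_iff by blast
  have "0 \<le> (\<integral>x. indicator D' x * h x \<partial>M)"
  proof (rule maximal_inequality[OF h D'_sets])
    show "\<alpha> [a] x \<in> D' \<longleftrightarrow> x \<in> D'" if "x \<in> space M" for a x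
      using D'_iff[of "[a]" x] that by (simp add: reduced_Cons)
    show "D' \<subseteq> unbounded_gain (reversal \<pi> P) (\<lambda>a. \<alpha> [a]) h b" for b
    proof
      fix x assume "x \<in> D'"
      then have "\<alpha> [] x \<in> D b" "x \<in> space M" unfolding D'_def by auto
      then show "x \<in> unbounded_gain (reversal \<pi> P) (\<lambda>a. \<alpha> [a]) h b"
        by (simp add: action_Nil[OF act] D_def)
    qed
  qed
  also have "(\<integral>x. indicator D' x * h x \<partial>M)
      = (\<integral>x. indicator D' x * f x - indicator D' x * g x - \<epsilon> * indicator D' x \<partial>M)"
    by (simp add: h_def algebra_simps)
  also have "\<dots> = (\<integral>x. indicator D' x * f x \<partial>M) - (\<integral>x. indicator D' x * g x \<partial>M) - \<epsilon> * measure M D'"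
    using D'_sets integrable_mult_indicator[OF D'_sets f] integrable_mult_indicator[OF D'_sets g]
    by (simp add: emeasure_eq_measure)
  also have "\<dots> = - \<epsilon> * measure M D'"
    using fg[OF inv] by (simp add: set_lebesgue_integral_def)
  finally have "measure M D' = 0"
    using \<epsilon> measure_nonneg[of M D'] by (simp add: mult_le_0_iff)
  then have "AE x in M. x \<notin> D'"
    using D'_sets by (intro AE_not_in) (simp add: null_sets_def emeasure_eq_measure)
  moreover have "AE x in M. \<forall>w. reduced_word w \<longrightarrow> (\<forall>b. \<alpha> w x \<in> D b \<longleftrightarrow> x \<in> D b\<^sub>0)"
    unfolding AE_all_countable
  proof
    fix w show "AE x in M. reduced_word w \<longrightarrow> (\<forall>b. \<alpha> w x \<in> D b \<longleftrightarrow> x \<in> D b\<^sub>0)"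
      by (cases "reduced_word w") (simp_all add: AE_w)
  qed
  ultimately show ?thesis
    using AE_space
  proof eventually_elim
    case (elim x)
    have "x \<notin> D b" for b
    proof
      assume "x \<in> D b"
      then have "x \<in> D b\<^sub>0" using elim(2)[rule_format, of "[]" b] action_Nil[OF act elim(3)] by simp
      then have "x \<in> D'" using elim(2,3) by (simp add: D'_def)
      then show False using elim(1) by blast
    qed
    then show ?case by (simp add: D_def h_def)
  qed
qed

text \<open>Averaging the bounds for \<open>weight_before\<close> over the next letter gives a bound for the Markov measure. The
  invariance of \<open>g\<close> makes its tree sum the multiple \<open>g x\<close> of the mass of the tree.\<close>

lemma AE_tree_sum_bounded:
  fixes \<pi> :: "'g::finite letter \<Rightarrow> real" and f g :: "'x \<Rightarrow> real"
  assumes pmp: "pmp_action free_group M \<alpha>" and mc: "markov_chain \<pi> P" and st: "stationary \<pi> P"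
    and pos: "\<forall>a. 0 < \<pi> a" and supp: "\<And>a. P a (letter_inv a) = 0"
    and wm: "weakly_mixing free_group (boundary_measure \<pi> P) boundary_action"
    and f: "integrable M f" and g: "integrable M g"
    and fg: "\<And>A. A \<in> invariant_sets free_group M \<alpha> \<Longrightarrow> (\<integral>x\<in>A. f x \<partial>M) = (\<integral>x\<in>A. g x \<partial>M)"
    and g_inv: "\<And>w x. w \<in> carrier free_group \<Longrightarrow> x \<in> space M \<Longrightarrow> g (\<alpha> w x) = g x"
    and \<epsilon>: "0 < \<epsilon>"
  shows "AE x in M. \<exists>C. \<forall>\<tau>. finite \<tau> \<and> cayley_subtree \<tau> \<and> [] \<in> \<tau> \<longrightarrow>
    (\<Sum>w\<in>\<tau>. f (\<alpha> w x) * markov_measure \<pi> P w) - g x * (\<Sum>w\<in>\<tau>. markov_measure \<pi> P w)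
      \<le> \<epsilon> * (\<Sum>w\<in>\<tau>. markov_measure \<pi> P w) + C"
proof -
  have "AE x in M. \<forall>b. x \<notin> unbounded_gain (reversal \<pi> P) (\<lambda>a. \<alpha> [a]) (\<lambda>x. f x - g x - \<epsilon>) b"
    by (rule AE_bounded_gain[OF pmp mc st pos supp wm f g _ \<epsilon>]) (rule fg)
  then show ?thesis
    using AE_space
  proof eventually_elim
    case (elim x)
    let ?h = "\<lambda>x. f x - g x - \<epsilon>"
    let ?best = "best (reversal \<pi> P) (\<lambda>a. \<alpha> [a]) ?h"
    have act: "group_action free_group (space M) \<alpha>" using pmp by (simp add: pmp_action_def)
    have "\<exists>C. \<forall>n. ?best n b x \<le> C" for b
      by (rule bounded_gain) (use elim(1) in blast)
    then obtain C where C: "\<And>b n. ?best n b x \<le> C b" by metis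
    show ?case
    proof (intro exI allI impI, elim conjE)
      fix \<tau> :: "'g letter list set" assume \<tau>: "finite \<tau>" "cayley_subtree \<tau>" "[] \<in> \<tau>"
      have red: "\<tau> \<subseteq> {w. reduced_word w}" using \<tau>(2) by (simp add: cayley_subtree_def)
      obtain n where n: "\<forall>w\<in>\<tau>. length w < n"
        using \<tau>(1) finite_nat_set_iff_bounded[of "length ` \<tau>"] by auto
      let ?m = "markov_measure \<pi> P"
      have "(\<Sum>w\<in>\<tau>. f (\<alpha> w x) * ?m w) - g x * (\<Sum>w\<in>\<tau>. ?m w) - \<epsilon> * (\<Sum>w\<in>\<tau>. ?m w) = (\<Sum>w\<in>\<tau>. ?h (\<alpha> w x) * ?m w)"
        using red elim(2) g_inv
        by (auto simp: sum_distrib_left sum_subtractf[symmetric] algebra_simps intro!: sum.cong)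
      also have "\<dots> = (\<Sum>w\<in>\<tau>. \<Sum>b\<in>UNIV. \<pi> b * (?h (\<alpha> w x) * weight_before \<pi> P b w))"
        by (simp only: sum_weight_before[OF mc pos, symmetric] sum_distrib_left mult.left_commute)
      also have "\<dots> = (\<Sum>b\<in>UNIV. \<pi> b * (\<Sum>w\<in>\<tau>. ?h (\<alpha> w x) * weight_before \<pi> P b w))"
        by (subst sum.swap) (simp only: sum_distrib_left)
      also have "\<dots> \<le> (\<Sum>b\<in>UNIV. \<pi> b * C b)"
      proof (intro sum_mono mult_left_mono)
        fix b
        show "(\<Sum>w\<in>\<tau>. ?h (\<alpha> w x) * weight_before \<pi> P b w) \<le> C b"
          using tree_sum_le_best[OF act mc pos \<tau>(1) suffix_closed_subtree[OF \<tau>(2,3)] red n elim(2), of ?h b] C[of n b]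
          by linarith
        show "0 \<le> \<pi> b" using pos by (simp add: less_imp_le)
      qed
      finally show "(\<Sum>w\<in>\<tau>. f (\<alpha> w x) * ?m w) - g x * (\<Sum>w\<in>\<tau>. ?m w) \<le> \<epsilon> * (\<Sum>w\<in>\<tau>. ?m w) + (\<Sum>b\<in>UNIV. \<pi> b * C b)"
        by simp
    qed
  qed
qed

section \<open>Convergence along trees\<close>

theorem theorem6p1:
  fixes M :: "'x measure"
    and \<alpha> :: "'g::finite letter list \<Rightarrow> 'x \<Rightarrow> 'x"
    and \<pi> :: "'g letter \<Rightarrow> real"
    and P :: "'g letter \<Rightarrow> 'g letter \<Rightarrow> real"
    and f :: "'x \<Rightarrow> real"
  assumes "2 \<le> CARD('g)"
    and "standard_borel M"
    and "pmp_action free_group M \<alpha>"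
    and "markov_chain \<pi> P" and "stationary \<pi> P"
    and "\<forall>a. 0 < \<pi> a"
    and "{w. markov_measure \<pi> P w \<noteq> 0} \<subseteq> carrier free_group"
    and "weakly_mixing free_group (boundary_measure \<pi> P) boundary_action"
    and "integrable M f"
  shows "AE x in M. \<forall>\<epsilon>>0. \<exists>K>0. \<forall>\<tau>.
           finite \<tau> \<and> cayley_subtree \<tau> \<and> \<one>\<^bsub>free_group\<^esub> \<in> \<tau> \<and>
           K \<le> (\<Sum>w\<in>\<tau>. markov_measure \<pi> P w) \<longrightarrow>
           \<bar>(\<Sum>w\<in>\<tau>. f (\<alpha> w x) * markov_measure \<pi> P w) / (\<Sum>w\<in>\<tau>. markov_measure \<pi> P w)
              - real_cond_exp M (invariant_algebra free_group M \<alpha>) f x\<bar> < \<epsilon>"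
proof -
  note pmp = assms(3) and mc = assms(4) and st = assms(5) and pos = assms(6) and wm = assms(8) and f = assms(9)
  have act: "group_action free_group (space M) \<alpha>" and "prob_space M" using pmp by (simp_all add: pmp_action_def)
  interpret prob_space M by fact
  let ?F = "invariant_algebra free_group M \<alpha>"
  interpret S: finite_measure_subalgebra M ?F
    by unfold_locales (rule subalgebra_invariant[OF act])
  define g where "g = real_cond_exp M ?F f"
  have g: "integrable M g" unfolding g_def using f by (rule S.real_cond_exp_int)
  have g_inv: "g (\<alpha> w x) = g x" if "w \<in> carrier free_group" "x \<in> space M" for w x
    using invariant_function[OF act _ that, of g] by (simp add: g_def)
  have fg: "(\<integral>x\<in>A. f x \<partial>M) = (\<integral>x\<in>A. g x \<partial>M)" if "A \<in> invariant_sets free_group M \<alpha>" for A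
    unfolding g_def using that by (intro S.real_cond_exp_intA f) (simp add: sets_invariant_algebra[OF act])
  have supp: "P a (letter_inv a) = 0" for a
  proof -
    have "markov_measure \<pi> P [a, letter_inv a] = 0"
      using assms(7) by (auto simp: reduced_Cons)
    then show ?thesis using pos[rule_format, of a] by (simp add: markov_measure_def)
  qed
  let ?m = "markov_measure \<pi> P"
  \<comment> \<open>Countably many \<open>\<epsilon>\<close> suffice, so that one null set serves for all.\<close>
  define e where "e n = inverse (real (Suc n))" for n
  have e: "0 < e n" for n by (simp add: e_def)
  have upper: "AE x in M. \<exists>C. \<forall>\<tau>. finite \<tau> \<and> cayley_subtree \<tau> \<and> [] \<in> \<tau> \<longrightarrow>
      (\<Sum>w\<in>\<tau>. f (\<alpha> w x) * ?m w) - g x * sum ?m \<tau> \<le> e n * sum ?m \<tau> + C" for n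
    by (rule AE_tree_sum_bounded[OF pmp mc st pos supp wm f g _ _ e]) (use fg g_inv in auto)
  have lower: "AE x in M. \<exists>C. \<forall>\<tau>. finite \<tau> \<and> cayley_subtree \<tau> \<and> [] \<in> \<tau> \<longrightarrow>
      (\<Sum>w\<in>\<tau>. - f (\<alpha> w x) * ?m w) - - g x * sum ?m \<tau> \<le> e n * sum ?m \<tau> + C" for n
  proof (rule AE_tree_sum_bounded[OF pmp mc st pos supp wm _ _ _ _ e])
    show "(\<integral>x\<in>A. - f x \<partial>M) = (\<integral>x\<in>A. - g x \<partial>M)" if "A \<in> invariant_sets free_group M \<alpha>" for A
      using fg[OF that] by (simp add: set_lebesgue_integral_def)
  qed (use f g g_inv in auto)
  have "AE x in M. \<forall>n. \<exists>C. \<forall>\<tau>. finite \<tau> \<and> cayley_subtree \<tau> \<and> [] \<in> \<tau> \<longrightarrow>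
      (\<Sum>w\<in>\<tau>. f (\<alpha> w x) * ?m w) - g x * sum ?m \<tau> \<le> e n * sum ?m \<tau> + C"
    unfolding AE_all_countable using upper by blast
  moreover have "AE x in M. \<forall>n. \<exists>C. \<forall>\<tau>. finite \<tau> \<and> cayley_subtree \<tau> \<and> [] \<in> \<tau> \<longrightarrow>
      (\<Sum>w\<in>\<tau>. - f (\<alpha> w x) * ?m w) - - g x * sum ?m \<tau> \<le> e n * sum ?m \<tau> + C"
    unfolding AE_all_countable using lower by blast
  ultimately show ?thesis
  proof eventually_elim
    case (elim x)
    show ?case
    proof (intro allI impI)
      fix \<epsilon> :: real assume \<epsilon>: "0 < \<epsilon>"
      obtain n where n: "e n < \<epsilon> / 2"
        using reals_Archimedean[of "\<epsilon> / 2"] \<epsilon> by (auto simp: e_def)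
      obtain C\<^sub>1 where C1: "\<And>\<tau>. finite \<tau> \<Longrightarrow> cayley_subtree \<tau> \<Longrightarrow> [] \<in> \<tau> \<Longrightarrow>
          (\<Sum>w\<in>\<tau>. f (\<alpha> w x) * ?m w) - g x * sum ?m \<tau> \<le> e n * sum ?m \<tau> + C\<^sub>1"
        using elim(1) by blast
      obtain C\<^sub>2 where C2: "\<And>\<tau>. finite \<tau> \<Longrightarrow> cayley_subtree \<tau> \<Longrightarrow> [] \<in> \<tau> \<Longrightarrow>
          (\<Sum>w\<in>\<tau>. - f (\<alpha> w x) * ?m w) - - g x * sum ?m \<tau> \<le> e n * sum ?m \<tau> + C\<^sub>2"
        using elim(2) by blast
      define C where "C = max 1 (max C\<^sub>1 C\<^sub>2)"
      have C: "0 < C" "C\<^sub>1 \<le> C" "C\<^sub>2 \<le> C" by (auto simp: C_def)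
      show "\<exists>K>0. \<forall>\<tau>. finite \<tau> \<and> cayley_subtree \<tau> \<and> \<one>\<^bsub>free_group\<^esub> \<in> \<tau> \<and> K \<le> (\<Sum>w\<in>\<tau>. ?m w) \<longrightarrow>
          \<bar>(\<Sum>w\<in>\<tau>. f (\<alpha> w x) * ?m w) / (\<Sum>w\<in>\<tau>. ?m w) - real_cond_exp M ?F f x\<bar> < \<epsilon>"
      proof (intro exI[of _ "2 * C / \<epsilon>"] conjI allI impI, goal_cases)
        case 1
        show ?case using C \<epsilon> by simp
      next
        case (2 \<tau>)
        then have \<tau>: "finite \<tau>" "cayley_subtree \<tau>" "[] \<in> \<tau>" and K: "2 * C / \<epsilon> \<le> sum ?m \<tau>" by auto
        have m: "0 < sum ?m \<tau>" using K C \<epsilon> by (meson divide_pos_pos less_le_trans mult_pos_pos zero_less_numeral)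
        have "C \<le> \<epsilon> / 2 * sum ?m \<tau>" using K \<epsilon> by (simp add: field_simps)
        moreover have "e n * sum ?m \<tau> < \<epsilon> / 2 * sum ?m \<tau>" using n m by (rule mult_strict_right_mono)
        ultimately have small: "e n * sum ?m \<tau> + C < \<epsilon> * sum ?m \<tau>" by (simp add: field_simps)
        let ?s = "\<Sum>w\<in>\<tau>. f (\<alpha> w x) * ?m w"
        have "?s - g x * sum ?m \<tau> < \<epsilon> * sum ?m \<tau>"
          using C1[OF \<tau>] C(2) small by linarith
        moreover have "g x * sum ?m \<tau> - ?s < \<epsilon> * sum ?m \<tau>"
          using C2[OF \<tau>] C(3) small by (simp add: sum_negf)
        ultimately have "\<bar>?s - g x * sum ?m \<tau>\<bar> < \<epsilon> * sum ?m \<tau>" by linarith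
        moreover have "?s / sum ?m \<tau> - g x = (?s - g x * sum ?m \<tau>) / sum ?m \<tau>"
          using m by (simp add: field_simps)
        ultimately show ?case
          using m by (simp add: g_def[symmetric] abs_divide divide_less_eq)
      qed
    qed
  qed
qed

end
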